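(* Let $n$ be a positive integer, let $a,b,c,d\in\mathbb{R}$, let $q(y,z)=a y^3+b y^2z+c yz^2+d z^3$, and let $Q_N:\mathbb{R}^n\to\mathbb{R}^n$, $$Q_N(x)=(q(x_1,x_n),q(x_2,x_1),\dots,q(x_n,x_{n-1})).$$ For $k\in\mathbb{R}$ put $$\begin{aligned} \Delta(k)={}&256(a-k)^{3}k^{3}-192(a-k)^{2}bdk^{2}-128(a-k)^{2}c^{2}k^{2}+144(a-k)^{2}cd^{2}k-27(a-k)^{2}d^{4}\\ &+144(a-k)b^{2}ck^{2}-6(a-k)b^{2}d^{2}k-80(a-k)bc^{2}dk+18(a-k)bcd^{3}+16(a-k)c^{4}k\\ &-4(a-k)c^{3}d^{2}-27b^{4}k^{2}+18b^{3}cdk-4b^{3}d^{3}-4b^{2}c^{3}k+b^{2}c^{2}d^{2},\\ P(k)={}&8(a-k)c-3b^{2},\\ D(k)={}&64(a-k)^{3}k-16(a-k)^{2}c^{2}+16(a-k)b^{2}c-16(a-k)^{2}bd-3b^{4},\\ R(k)={}&b^{3}+8d(a-k)^{2}-4(a-k)bc. \end{aligned}$$ Suppose there exists $k$ with $a<k<0$ such that $$\bigl(\Delta(k)>0\ \wedge\ (P(k)>0\ \vee\ D(k)>0)\bigr)\ \vee\ \bigl(\Delta(k)=D(k)=R(k)=0\ \wedge\ P(k)>0\bigr).$$ Then for every $\lambda>0$ there exists a unique $(n-1)$-dimensional sphere $S(\lambda)\subset\mathbb{R}^n\setminus\{0\}$ which is invariant by the flow of $$\dot{x}=\lambda x+Q_N(x).$$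 Moreover, $S(\lambda)$ is globally attracting, and the flow restricted to $S(\lambda)$ is topologically equivalent to the flow on the unit sphere $S^{n-1}$ of the system $$\dot{u}=\mathcal{P}_{Q_N}(u),\qquad \mathcal{P}_{Q_N}(u)=Q_N(u)-\langle Q_N(u),u\rangle u,\quad u\in S^{n-1}.$$
   Context: $\langle\cdot,\cdot\rangle$ is the Euclidean inner product on $\mathbb{R}^n$ and $S^{n-1}$ is the unit sphere. An $(n-1)$-dimensional sphere in $\mathbb{R}^n\setminus\{0\}$ means a subset homeomorphic to $S^{n-1}$ (embedded as a topological submanifold). "Globally attracting" means that every trajectory $x(t)$ with nonzero initial condition is asymptotic to $S(\lambda)$ as $t\to\infty$. Two flows are topologically equivalent if there is a homeomorphism taking the orbits of one onto orbits of the other and preserving the direction of time. *)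

theory Defs
  imports "HOL-Analysis.Analysis"
begin

definition solves_on :: "('a::real_normed_vector \<Rightarrow> 'a) \<Rightarrow> real set \<Rightarrow> (real \<Rightarrow> 'a) \<Rightarrow> bool" where
  "solves_on f T x \<longleftrightarrow> open T \<and> is_interval T \<and> 0 \<in> T \<and>
     (\<forall>t\<in>T. (x has_vector_derivative f (x t)) (at t))"

text \<open>The values of \<open>x\<close> outside its interval of existence \<open>T\<close> are irrelevant.\<close>

definition trajectory :: "('a::real_normed_vector \<Rightarrow> 'a) \<Rightarrow> real set \<Rightarrow> (real \<Rightarrow> 'a) \<Rightarrow> bool" where
  "trajectory f T x \<longleftrightarrow> solves_on f T x \<and>
     (\<forall>T' y. solves_on f T' y \<and> T \<subseteq> T' \<and> (\<forall>t\<in>T. y t = x t) \<longrightarrow> T' = T)"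

definition flow_invariant :: "('a::real_normed_vector \<Rightarrow> 'a) \<Rightarrow> 'a set \<Rightarrow> bool" where
  "flow_invariant f M \<longleftrightarrow> (\<forall>T x. trajectory f T x \<and> x 0 \<in> M \<longrightarrow> x ` T \<subseteq> M)"

definition globally_attracting :: "('a::real_normed_vector \<Rightarrow> 'a) \<Rightarrow> 'a set \<Rightarrow> bool" where
  "globally_attracting f S \<longleftrightarrow>
     (\<forall>T x. trajectory f T x \<and> x 0 \<noteq> 0 \<longrightarrow>
        {0..} \<subseteq> T \<and> ((\<lambda>t. infdist (x t) S) \<longlongrightarrow> 0) at_top)"

text \<open>Equivalence of the flow of \<open>f\<close> restricted to \<open>M\<close> with the flow of \<open>g\<close> restricted to \<open>N\<close>.
  The increasing surjection \<open>\<tau>\<close> between the intervals of existence says that the homeomorphism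
  takes the orbit \<open>x ` T\<close> onto the orbit \<open>y ` T'\<close> and respects the direction of time. As the orbits
  partition \<open>M\<close> and \<open>N\<close>, every orbit in \<open>N\<close> is then the image of an orbit in \<open>M\<close>.\<close>

definition topologically_equivalent ::
    "('a::real_normed_vector \<Rightarrow> 'a) \<Rightarrow> 'a set \<Rightarrow> ('b::real_normed_vector \<Rightarrow> 'b) \<Rightarrow> 'b set \<Rightarrow> bool" where
  "topologically_equivalent f M g N \<longleftrightarrow>
     flow_invariant f M \<and> flow_invariant g N \<and>
     (\<exists>h h'. homeomorphism M N h h' \<and>
        (\<forall>T x. trajectory f T x \<and> x 0 \<in> M \<longrightarrow>
           (\<exists>T' y \<tau>. trajectory g T' y \<and> strict_mono_on T \<tau> \<and> \<tau> ` T = T' \<and>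
              (\<forall>t\<in>T. h (x t) = y (\<tau> t)))))"

definition is_sphere :: "(real ^ 'n) set \<Rightarrow> bool" where
  "is_sphere S \<longleftrightarrow> S homeomorphic sphere (0 :: real ^ 'n) 1"

definition projected_field :: "('a::real_inner \<Rightarrow> 'a) \<Rightarrow> 'a \<Rightarrow> 'a" where
  "projected_field Q u = Q u - (Q u \<bullet> u) *\<^sub>R u"

definition cubic :: "real \<Rightarrow> real \<Rightarrow> real \<Rightarrow> real \<Rightarrow> real \<Rightarrow> real \<Rightarrow> real" where
  "cubic a b c d y z = a * y ^ 3 + b * y ^ 2 * z + c * y * z ^ 2 + d * z ^ 3"

text \<open>A bijection \<open>e\<close> from \<open>{1..CARD('n)}\<close> to \<open>'n\<close> names the coordinates: \<open>x\<^sub>i\<close> is \<open>x $ e i\<close>.\<close>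

definition cyclic_pred :: "(nat \<Rightarrow> 'n::finite) \<Rightarrow> 'n \<Rightarrow> 'n" where
  "cyclic_pred e j =
     (let i = inv_into {1..CARD('n)} e j in e (if i = 1 then CARD('n) else i - 1))"

definition Q_N :: "(nat \<Rightarrow> 'n::finite) \<Rightarrow> (real \<Rightarrow> real \<Rightarrow> real) \<Rightarrow> real ^ 'n \<Rightarrow> real ^ 'n" where
  "Q_N e q x = (\<chi> j. q (x $ j) (x $ cyclic_pred e j))"

lemma Q_N_nth:
  fixes e :: "nat \<Rightarrow> 'n::finite"
  assumes "bij_betw e {1..CARD('n)} UNIV" and "i \<in> {1..CARD('n)}"
  shows "Q_N e q x $ e i = q (x $ e i) (x $ e (if i = 1 then CARD('n) else i - 1))"
proof -
  have "inv_into {1..CARD('n)} e (e i) = i"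
    using assms by (simp add: bij_betw_def inv_into_f_f)
  then show ?thesis
    by (simp add: Q_N_def cyclic_pred_def)
qed

text \<open>The discriminant and the classical auxiliary quantities deciding the nature of the roots of the quartic
  \<open>(a - k) y\<^sup>4 + b y\<^sup>3 z + c y\<^sup>2 z\<^sup>2 + d y z\<^sup>3 + k z\<^sup>4\<close>, which is \<open>y q(y,z) - k (y\<^sup>4 - z\<^sup>4)\<close>.\<close>

definition quartic_Delta :: "real \<Rightarrow> real \<Rightarrow> real \<Rightarrow> real \<Rightarrow> real \<Rightarrow> real" where
  "quartic_Delta a b c d k =
     256 * (a - k)^3 * k^3 - 192 * (a - k)^2 * b * d * k^2 - 128 * (a - k)^2 * c^2 * k^2
     + 144 * (a - k)^2 * c * d^2 * k - 27 * (a - k)^2 * d^4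
     + 144 * (a - k) * b^2 * c * k^2 - 6 * (a - k) * b^2 * d^2 * k - 80 * (a - k) * b * c^2 * d * k
     + 18 * (a - k) * b * c * d^3 + 16 * (a - k) * c^4 * k
     - 4 * (a - k) * c^3 * d^2 - 27 * b^4 * k^2 + 18 * b^3 * c * d * k - 4 * b^3 * d^3
     - 4 * b^2 * c^3 * k + b^2 * c^2 * d^2"

definition quartic_P :: "real \<Rightarrow> real \<Rightarrow> real \<Rightarrow> real \<Rightarrow> real \<Rightarrow> real" where
  "quartic_P a b c d k = 8 * (a - k) * c - 3 * b^2"

definition quartic_D :: "real \<Rightarrow> real \<Rightarrow> real \<Rightarrow> real \<Rightarrow> real \<Rightarrow> real" where
  "quartic_D a b c d k =
     64 * (a - k)^3 * k - 16 * (a - k)^2 * c^2 + 16 * (a - k) * b^2 * c - 16 * (a - k)^2 * b * d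
     - 3 * b^4"

definition quartic_R :: "real \<Rightarrow> real \<Rightarrow> real \<Rightarrow> real \<Rightarrow> real \<Rightarrow> real" where
  "quartic_R a b c d k = b^3 + 8 * d * (a - k)^2 - 4 * (a - k) * b * c"

end

(*
Write q_k(y,z) for y q(y,z) - k (y^4 - z^4). The hypothesis on k says that this quartic form has no real
zero, so it is negative definite; summing q_k(x_i, x_{i-1}) over i, the terms k (x_i^4 - x_{i-1}^4) cancel
and <Q(x), x> < 0 for x \<noteq> 0.

For such a homogeneous cubic Q the field F(x) = Q(x) / |x|^2 is globally Lipschitz, with a complete flow psi.
It has the orbits of x' = Q(x), where the time s of Q satisfies ds = dt / |psi|^2. Going backwards, solutions
of x' = Q(x) reach infinity after a finite time age(x), which is continuous and homogeneous of degree -2. If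
y solves y' = Q(y), then e^(lam t) y((e^(2 lam t) - 1) / (2 lam)) solves x' = lam x + Q(x), and along
it the age minus 1/(2 lam) is multiplied by e^(-2 lam t). So the sphere is {age = 1/(2 lam)}: it attracts
everything, and on every compact invariant set away from 0 the age is bounded above and away from 0, hence
equal to 1/(2 lam). Such a set lies in the sphere, and equals it if it is a sphere itself, by invariance of
domain. The radial projection maps psi to the flow of the projected field.
*)
theory Submission
  imports Defs
begin

section \<open>Definiteness of the quartic form\<close>

text \<open>Solutions of x' = Q(x) are not complete: they blow up backwards in finite time.
  \<open>age\<close> measures exactly this blow-up time, and the complete flow \<open>psi\<close>
  allows it to be written as an integral over a whole half line, so no theory of maximal solutions
  has to come first. Maximal trajectories enter only when they are compared with an explicit
  formula. The level 1/(2 lam) comes from a scalar linear equation. Along x' = Q(x) the age grows at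
  unit speed; by homogeneity of degree -2 the term lam x adds -2 lam age. Hence age' = 1 - 2 lam age
  along the full field, with rest point 1/(2 lam). Homogeneity also makes every ray from 0 meet that
  level exactly once, so the sphere is a radial graph over the unit sphere. The algebraic hypothesis
  enters only through the sign of <Q(x), x>. It is exploited by contradiction: a real root is split
  off from the quartic, and the invariants are recomputed from the remaining cubic.\<close>

lemma quartic_no_real_root:
  fixes a b c d k y :: real
  assumes ne: "a - k \<noteq> 0"
    and h: "(quartic_Delta a b c d k > 0 \<and> (quartic_P a b c d k > 0 \<or> quartic_D a b c d k > 0)) \<or>
       (quartic_Delta a b c d k = 0 \<and> quartic_D a b c d k = 0 \<and> quartic_R a b c d k = 0 \<and>
        quartic_P a b c d k > 0)"
  shows "(a - k) * y^4 + b * y^3 + c * y^2 + d * y + k \<noteq> 0"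
proof
  \<comment> \<open>\<open>A\<close>, \<open>B\<close>, \<open>C\<close>, \<open>E\<close> are the
    Taylor coefficients of the quartic at the assumed root \<open>y\<close>. The constant one
    vanishes, so the translated quartic is t (A t^3 + B t^2 + C t + E), and \<open>disc\<close> is
    the discriminant of the cubic factor.\<close>
  define A where "A = a - k"
  define B where "B = b + 4*A*y"
  define C where "C = c + 3*b*y + 6*A*y^2"
  define E where "E = d + 2*c*y + 3*b*y^2 + 4*A*y^3"
  define disc where "disc = B^2*C^2 - 4*A*C^3 - 4*B^3*E + 18*A*B*C*E - 27*A^2*E^2"
  \<comment> \<open>With s = 3 A t + B the cubic becomes depressed: 27 A^2 (A t^3 + B t^2 + C t + E)
    = s^3 - 3 H s + K.\<close>
  define H where "H = B^2 - 3*A*C"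
  define K where "K = 2*B^3 - 9*A*B*C + 27*A^2*E"
  assume "(a - k) * y^4 + b * y^3 + c * y^2 + d * y + k = 0"
  then have k: "k = - (A * y^4 + b * y^3 + c * y^2 + d * y)"
    unfolding A_def by algebra
  \<comment> \<open>\<open>I\<close> and \<open>J\<close> are the invariants of the quartic; they do not change under the translation by \<open>y\<close>.\<close>
  define I where "I = 12*A*k - 3*b*d + c^2"
  define J where "J = 72*A*c*k + 9*b*c*d - 27*A*d^2 - 27*k*b^2 - 2*c^3"
  have I: "I = C^2 - 3*B*E"
    unfolding I_def k B_def C_def E_def by algebra
  have J: "J = 9*B*C*E - 27*A*E^2 - 2*C^3"
    unfolding J_def k B_def C_def E_def by algebra
  have "27 * quartic_Delta a b c d k = 4*I^3 - J^2"
    unfolding quartic_Delta_def A_def[symmetric] I_def J_def by algebra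
  moreover have "4*I^3 - J^2 = 27 * (E^2 * disc)"
    unfolding I J disc_def by algebra
  ultimately have Delta: "quartic_Delta a b c d k = E^2 * disc" by simp
  have P: "quartic_P a b c d k = 8*A*C - 3*B^2"
    unfolding quartic_P_def A_def[symmetric] B_def C_def by algebra
  have D: "quartic_D a b c d k = - 16*A^2*C^2 + 16*A*B^2*C - 16*A^2*B*E - 3*B^4"
    unfolding quartic_D_def A_def[symmetric] unfolding k B_def C_def E_def by algebra
  have R: "quartic_R a b c d k = B^3 + 8*E*A^2 - 4*A*B*C"
    unfolding quartic_R_def A_def[symmetric] B_def C_def E_def by algebra
  have disc: "27*A^2*disc = 4*H^3 - K^2"
    unfolding disc_def H_def K_def by algebra
  have P': "3 * quartic_P a b c d k = - (B^2 + 8*H)"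
    unfolding P H_def by algebra
  have D': "27 * quartic_D a b c d k = - (48*H^2 + 16*(B*K) + B^4)"
    unfolding D H_def K_def by algebra
  from h show False
  proof
    \<comment> \<open>A positive discriminant of the cubic means three distinct real roots, so that
      the quartic would have four; in that situation neither \<open>quartic_P\<close> nor
      \<open>quartic_D\<close> can be positive.\<close>
    assume pos: "quartic_Delta a b c d k > 0 \<and> (quartic_P a b c d k > 0 \<or> quartic_D a b c d k > 0)"
    then have "E^2 * disc > 0" using Delta by simp
    then have "disc > 0" by (metis zero_le_power2 mult_nonneg_nonpos not_le)
    then have "4*H^3 > K^2"
      using disc ne by (metis A_def diff_gt_0_iff_gt mult_pos_pos zero_less_numeral zero_less_power2)
    then have HK: "4*H^3 > K^2" and "H^3 > 0" using zero_le_power2[of K] by linarith+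
    then have "H > 0" by (simp add: zero_less_power_eq)
    have "\<not> quartic_P a b c d k > 0"
      using P' \<open>H > 0\<close> zero_le_power2[of B] by linarith
    moreover have "\<not> quartic_D a b c d k > 0"
    proof -
      \<comment> \<open>Since |K| is at most 2 g^3, the value of -27 \<open>quartic_D\<close> is at
        least 48 g^4 - 32 |B| g^3 + |B|^4. This polynomial has the double zero |B| = 2 g, which is
        why a square factors out.\<close>
      define g where "g = sqrt H"
      have g: "H = g^2" "g > 0" using \<open>H > 0\<close> by (auto simp: g_def)
      have "K^2 \<le> (2*g^3)^2" using HK g by (simp add: power_mult_distrib flip: power_mult)
      then have "\<bar>K\<bar> \<le> 2*g^3" using g(2) abs_le_square_iff[of K "2*g^3"] by simp
      then have "\<bar>B\<bar> * \<bar>K\<bar> \<le> \<bar>B\<bar> * (2*g^3)" by (intro mult_left_mono) auto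
      then have "- (B*K) \<le> 2 * (\<bar>B\<bar> * g^3)" by (simp add: abs_mult[symmetric])
      moreover have "48*g^4 - 32*(\<bar>B\<bar>*g^3) + B^4 = (\<bar>B\<bar> - 2*g)^2 * ((\<bar>B\<bar> + 2*g)^2 + 8*g^2)"
      proof -
        have "B^4 = \<bar>B\<bar>^4" by simp
        then show ?thesis by algebra
      qed
      moreover have "(\<bar>B\<bar> - 2*g)^2 * ((\<bar>B\<bar> + 2*g)^2 + 8*g^2) \<ge> 0" by simp
      moreover have "H^2 = g^4" using g by (simp flip: power_mult)
      ultimately show ?thesis using D' by linarith
    qed
    ultimately show False using pos by blast
  next
    assume z: "quartic_Delta a b c d k = 0 \<and> quartic_D a b c d k = 0 \<and> quartic_R a b c d k = 0 \<and>
        quartic_P a b c d k > 0"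
    \<comment> \<open>The combination \<open>quartic_D\<close> + 2 B \<open>quartic_R\<close> equals
      -(4 A C - B^2)^2. Once this vanishes, \<open>quartic_P\<close> collapses to -B^2.\<close>
    have "(4*A*C - B^2)^2 = 0" using z D R by algebra
    then have "4*A*C = B^2" by simp
    then show False using z P zero_le_power2[of B] by linarith
  qed
qed

lemma quartic_form_neg:
  fixes a b c d k y z :: real
  assumes "a < k" "k < 0"
    and h: "(quartic_Delta a b c d k > 0 \<and> (quartic_P a b c d k > 0 \<or> quartic_D a b c d k > 0)) \<or>
       (quartic_Delta a b c d k = 0 \<and> quartic_D a b c d k = 0 \<and> quartic_R a b c d k = 0 \<and>
        quartic_P a b c d k > 0)"
    and nz: "y \<noteq> 0 \<or> z \<noteq> 0"
  shows "(a - k) * y^4 + b * y^3 * z + c * y^2 * z^2 + d * y * z^3 + k * z^4 < 0"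
proof (cases "z = 0")
  case True
  then show ?thesis using nz assms by (simp add: mult_neg_pos)
next
  case False
  define p where "p = (\<lambda>y. (a - k) * y^4 + b * y^3 + c * y^2 + d * y + k)"
  have nr: "p t \<noteq> 0" for t
    unfolding p_def using quartic_no_real_root[OF _ h] assms(1) by simp
  \<comment> \<open>A continuous function without zeros keeps the sign it has at 0, where its value
    is \<open>k\<close>.\<close>
  have neg: "p t < 0" for t
  proof (rule ccontr)
    assume "\<not> p t < 0"
    have "connected (range p)"
      by (intro connected_continuous_image) (auto simp: p_def intro!: continuous_intros)
    moreover have "p 0 < 0" using assms by (simp add: p_def)
    ultimately have "0 \<in> range p"
      using \<open>\<not> p t < 0\<close> connectedD_interval[of "range p" "p 0" "p t" 0] by auto
    then show False using nr by auto
  qed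
  have "(a - k) * y^4 + b * y^3 * z + c * y^2 * z^2 + d * y * z^3 + k * z^4 = z^4 * p (y/z)"
    using False unfolding p_def by (simp add: field_simps power2_eq_square power3_eq_cube power4_eq_xxxx)
  also have "\<dots> < 0" using neg False by (simp add: mult_pos_neg)
  finally show ?thesis .
qed

text \<open>Bijectivity permits reindexing the sum of fourth powers, so that the terms with factor
  \<open>k\<close> cancel.\<close>

lemma bij_cyclic_pred:
  fixes e :: "nat \<Rightarrow> 'n::finite"
  assumes e: "bij_betw e {1..CARD('n)} UNIV"
  shows "bij (cyclic_pred e)"
proof -
  have "inj (cyclic_pred e)"
  proof (rule injI)
    fix i j assume eq: "cyclic_pred e i = cyclic_pred e j"
    have inv: "bij_betw (inv_into {1..CARD('n)} e) UNIV {1..CARD('n)}"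
      using bij_betw_inv_into[OF e] .
    define k l where "k = inv_into {1..CARD('n)} e i" and "l = inv_into {1..CARD('n)} e j"
    have kl: "k \<in> {1..CARD('n)}" "l \<in> {1..CARD('n)}"
      using inv unfolding k_def l_def bij_betw_def by blast+
    have "e (if k = 1 then CARD('n) else k - 1) = e (if l = 1 then CARD('n) else l - 1)"
      using eq unfolding cyclic_pred_def Let_def k_def[symmetric] l_def[symmetric] .
    moreover have "(if k = 1 then CARD('n) else k - 1) \<in> {1..CARD('n)}"
      "(if l = 1 then CARD('n) else l - 1) \<in> {1..CARD('n)}"
      using kl by auto
    ultimately have "(if k = 1 then CARD('n) else k - 1) = (if l = 1 then CARD('n) else l - 1)"
      using e by (metis bij_betw_def inj_onD)
    then have "k = l" using kl by (auto split: if_splits)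
    then show "i = j"
      using inv unfolding k_def l_def bij_betw_def by (metis UNIV_I inj_onD)
  qed
  then show ?thesis by (simp add: bij_def finite_UNIV_inj_surj)
qed

lemma Q_N_inner_neg:
  fixes e :: "nat \<Rightarrow> 'n::finite" and x :: "real ^ 'n"
  assumes e: "bij_betw e {1..CARD('n)} UNIV" and "a < k" "k < 0"
    and h: "(quartic_Delta a b c d k > 0 \<and> (quartic_P a b c d k > 0 \<or> quartic_D a b c d k > 0)) \<or>
       (quartic_Delta a b c d k = 0 \<and> quartic_D a b c d k = 0 \<and> quartic_R a b c d k = 0 \<and>
        quartic_P a b c d k > 0)"
    and "x \<noteq> 0"
  shows "Q_N e (cubic a b c d) x \<bullet> x < 0"
proof -
  define p where "p = (\<lambda>y z. (a - k) * y^4 + b * y^3 * z + c * y^2 * z^2 + d * y * z^3 + k * z^4)"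
  let ?s = "cyclic_pred e"
  have tele: "(\<Sum>j\<in>UNIV. (x $ ?s j)^4) = (\<Sum>j\<in>UNIV. (x $ j)^4)"
    using sum.reindex_bij_betw[OF bij_cyclic_pred[OF e], of "\<lambda>j. (x $ j)^4"] by simp
  have pt: "cubic a b c d y z * y = p y z + k * (y^4 - z^4)" for y z
    unfolding cubic_def p_def by algebra
  have "Q_N e (cubic a b c d) x \<bullet> x = (\<Sum>j\<in>UNIV. p (x $ j) (x $ ?s j) + k * ((x $ j)^4 - (x $ ?s j)^4))"
    by (simp add: inner_vec_def Q_N_def pt)
  also have "\<dots> = (\<Sum>j\<in>UNIV. p (x $ j) (x $ ?s j))"
    by (simp add: sum.distrib sum_subtractf tele flip: sum_distrib_left)
  also have "\<dots> < 0"
  proof -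
    have le: "p y z \<le> 0" for y z
    proof (cases "y = 0 \<and> z = 0")
      case False
      then show ?thesis unfolding p_def
        using quartic_form_neg[OF assms(2,3) h, of y z] by auto
    qed (auto simp: p_def)
    obtain i where "x $ i \<noteq> 0" using \<open>x \<noteq> 0\<close> by (auto simp: vec_eq_iff)
    then have "p (x $ i) (x $ ?s i) < 0"
      unfolding p_def using quartic_form_neg[OF assms(2,3) h, of "x $ i" "x $ ?s i"] by auto
    then show ?thesis
      using sum_strict_mono_ex1[of UNIV "\<lambda>j. p (x $ j) (x $ ?s j)" "\<lambda>_. 0"] le by auto
  qed
  finally show ?thesis .
qed

lemma Q_N_cubic_scaleR: "Q_N e (cubic a b c d) (r *\<^sub>R x) = r^3 *\<^sub>R Q_N e (cubic a b c d) x"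
  by (simp add: vec_eq_iff Q_N_def cubic_def algebra_simps power2_eq_square power3_eq_cube)

text \<open>Each monomial is a product of three factors of modulus at most 1, so its variation is at
  most the sum of the variations of the factors. The unit square is enough, because homogeneity
  later carries the estimate to every ball.\<close>

lemma cubic_lipschitz:
  fixes y z y' z' :: real
  assumes "\<bar>y\<bar> \<le> 1" "\<bar>z\<bar> \<le> 1" "\<bar>y'\<bar> \<le> 1" "\<bar>z'\<bar> \<le> 1"
  shows "\<bar>cubic a b c d y z - cubic a b c d y' z'\<bar>
    \<le> 3 * (\<bar>a\<bar> + \<bar>b\<bar> + \<bar>c\<bar> + \<bar>d\<bar>) * (\<bar>y - y'\<bar> + \<bar>z - z'\<bar>)"
proof -
  have prod: "\<bar>s * t - s' * t'\<bar> \<le> \<bar>s - s'\<bar> + \<bar>t - t'\<bar>"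
    if "\<bar>t\<bar> \<le> 1" "\<bar>s'\<bar> \<le> 1" for s t s' t' :: real
  proof -
    have "s * t - s' * t' = (s - s') * t + s' * (t - t')" by algebra
    then have "\<bar>s * t - s' * t'\<bar> \<le> \<bar>s - s'\<bar> * \<bar>t\<bar> + \<bar>s'\<bar> * \<bar>t - t'\<bar>"
      by (metis abs_mult abs_triangle_ineq)
    also have "\<dots> \<le> \<bar>s - s'\<bar> * 1 + 1 * \<bar>t - t'\<bar>"
      using that by (intro add_mono mult_mono) auto
    finally show ?thesis by simp
  qed
  have m: "\<bar>r * s * t - r' * s' * t'\<bar> \<le> \<bar>r - r'\<bar> + \<bar>s - s'\<bar> + \<bar>t - t'\<bar>"
    if "\<bar>s\<bar> \<le> 1" "\<bar>t\<bar> \<le> 1" "\<bar>r'\<bar> \<le> 1" "\<bar>s'\<bar> \<le> 1" for r s t r' s' t' :: real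
  proof -
    have "\<bar>r' * s'\<bar> \<le> 1" using that by (simp add: abs_mult mult_le_one)
    then show ?thesis using prod[of t "r' * s'" "r * s" t'] prod[of s r' r s'] that by linarith
  qed
  define u where "u = \<bar>y - y'\<bar> + \<bar>z - z'\<bar>"
  have "\<bar>p * v\<bar> \<le> \<bar>p\<bar> * (3*u)" if "\<bar>v\<bar> \<le> 3*u" for p v
    using mult_left_mono[OF that, of "\<bar>p\<bar>"] by (simp add: abs_mult)
  moreover have "\<bar>y*y*y - y'*y'*y'\<bar> \<le> 3*u"
    by (rule order_trans[OF m]) (use assms in \<open>simp_all add: u_def\<close>)
  moreover have "\<bar>y*y*z - y'*y'*z'\<bar> \<le> 3*u"
    by (rule order_trans[OF m]) (use assms in \<open>simp_all add: u_def\<close>)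
  moreover have "\<bar>y*z*z - y'*z'*z'\<bar> \<le> 3*u"
    by (rule order_trans[OF m]) (use assms in \<open>simp_all add: u_def\<close>)
  moreover have "\<bar>z*z*z - z'*z'*z'\<bar> \<le> 3*u"
    by (rule order_trans[OF m]) (use assms in \<open>simp_all add: u_def\<close>)
  ultimately have le: "\<bar>a * (y*y*y - y'*y'*y')\<bar> \<le> \<bar>a\<bar> * (3*u)" "\<bar>b * (y*y*z - y'*y'*z')\<bar> \<le> \<bar>b\<bar> * (3*u)"
    "\<bar>c * (y*z*z - y'*z'*z')\<bar> \<le> \<bar>c\<bar> * (3*u)" "\<bar>d * (z*z*z - z'*z'*z')\<bar> \<le> \<bar>d\<bar> * (3*u)"
    by blast+
  have tri: "\<bar>p + q + r + s\<bar> \<le> p' + q' + r' + s'"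
    if "\<bar>p\<bar> \<le> p'" "\<bar>q\<bar> \<le> q'" "\<bar>r\<bar> \<le> r'" "\<bar>s\<bar> \<le> s'" for p q r s p' q' r' s' :: real
    using that by linarith
  have eq: "cubic a b c d y z - cubic a b c d y' z' = a * (y*y*y - y'*y'*y') + b * (y*y*z - y'*y'*z')
     + c * (y*z*z - y'*z'*z') + d * (z*z*z - z'*z'*z')"
    unfolding cubic_def by algebra
  have "3 * (\<bar>a\<bar> + \<bar>b\<bar> + \<bar>c\<bar> + \<bar>d\<bar>) * u = \<bar>a\<bar> * (3*u) + \<bar>b\<bar> * (3*u) + \<bar>c\<bar> * (3*u) + \<bar>d\<bar> * (3*u)"
    by algebra
  with tri[OF le] show ?thesis unfolding eq u_def by simp
qed

lemma Q_N_cubic_lipschitz: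
  fixes e :: "nat \<Rightarrow> 'n::finite"
  shows "\<exists>L. \<forall>x\<in>cball 0 1. \<forall>y\<in>cball 0 1.
    norm (Q_N e (cubic a b c d) x - Q_N e (cubic a b c d) y) \<le> L * norm (x - y)"
proof (intro exI ballI)
  fix x y :: "real ^ 'n" assume xy: "x \<in> cball 0 1" "y \<in> cball 0 1"
  define K where "K = 3 * (\<bar>a\<bar> + \<bar>b\<bar> + \<bar>c\<bar> + \<bar>d\<bar>)"
  have c1: "\<bar>x $ j\<bar> \<le> 1" "\<bar>y $ j\<bar> \<le> 1" "\<bar>x $ j - y $ j\<bar> \<le> norm (x - y)" for j
    using xy component_le_norm_cart[of x j] component_le_norm_cart[of y j]
      component_le_norm_cart[of "x - y" j] by auto
  have "\<bar>(Q_N e (cubic a b c d) x - Q_N e (cubic a b c d) y) $ j\<bar> \<le> K * (2 * norm (x - y))" for j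
  proof -
    have "\<bar>(Q_N e (cubic a b c d) x - Q_N e (cubic a b c d) y) $ j\<bar>
      \<le> K * (\<bar>x $ j - y $ j\<bar> + \<bar>x $ cyclic_pred e j - y $ cyclic_pred e j\<bar>)"
      unfolding K_def using cubic_lipschitz[OF c1(1,1,2,2)] by (simp add: Q_N_def del: distrib_left_numeral)
    also have "\<dots> \<le> K * (2 * norm (x - y))"
      using c1(3)[of j] c1(3)[of "cyclic_pred e j"] by (intro mult_left_mono) (auto simp: K_def)
    finally show ?thesis .
  qed
  then have "(\<Sum>j\<in>UNIV. \<bar>(Q_N e (cubic a b c d) x - Q_N e (cubic a b c d) y) $ j\<bar>)
      \<le> real CARD('n) * (K * (2 * norm (x - y)))"
    by (metis (no_types, lifting) sum_bounded_above)
  then show "norm (Q_N e (cubic a b c d) x - Q_N e (cubic a b c d) y) \<le> (real CARD('n) * K * 2) * norm (x - y)"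
    using norm_le_l1_cart[of "Q_N e (cubic a b c d) x - Q_N e (cubic a b c d) y"]
    by (simp add: algebra_simps)
qed

section \<open>Differential equations with a Lipschitz right-hand side\<close>

text \<open>The bound on |v'| works in both directions of time: v exp(-K t) is nonincreasing and v
  exp(K t) is nondecreasing.\<close>

lemma gronwall:
  fixes v v' :: "real \<Rightarrow> real"
  assumes T: "is_interval T"
    and v: "\<And>t. t \<in> T \<Longrightarrow> (v has_real_derivative v' t) (at t)"
    and le: "\<And>t. t \<in> T \<Longrightarrow> \<bar>v' t\<bar> \<le> K * v t"
    and st: "s \<in> T" "t \<in> T"
  shows "v t \<le> v s * exp (K * \<bar>t - s\<bar>)"
proof (cases "s \<le> t")
  case True
  have "v t * exp (- K * t) \<le> v s * exp (- K * s)"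
  proof (rule DERIV_nonpos_imp_nonincreasing[OF True])
    fix r assume "s \<le> r" "r \<le> t"
    then have r: "r \<in> T" using T st mem_is_interval_1_I by blast
    show "\<exists>y. ((\<lambda>t. v t * exp (- K * t)) has_real_derivative y) (at r) \<and> y \<le> 0"
    proof (intro exI conjI)
      show "((\<lambda>t. v t * exp (- K * t)) has_real_derivative (v' r - K * v r) * exp (- K * r)) (at r)"
        by (auto intro!: derivative_eq_intros v r simp: algebra_simps)
      show "(v' r - K * v r) * exp (- K * r) \<le> 0"
        using le[OF r] by (intro mult_nonpos_nonneg) auto
    qed
  qed
  then show ?thesis using True
    by (simp add: exp_minus exp_diff field_simps)
next
  case False
  then have ts: "t \<le> s" by simp
  have "v t * exp (K * t) \<le> v s * exp (K * s)"
  proof (rule DERIV_nonneg_imp_nondecreasing[OF ts])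
    fix r assume "t \<le> r" "r \<le> s"
    then have r: "r \<in> T" using T st mem_is_interval_1_I by blast
    show "\<exists>y. ((\<lambda>t. v t * exp (K * t)) has_real_derivative y) (at r) \<and> 0 \<le> y"
    proof (intro exI conjI)
      show "((\<lambda>t. v t * exp (K * t)) has_real_derivative (v' r + K * v r) * exp (K * r)) (at r)"
        by (auto intro!: derivative_eq_intros v r simp: algebra_simps)
      show "0 \<le> (v' r + K * v r) * exp (K * r)"
        using le[OF r] by (intro mult_nonneg_nonneg) auto
    qed
  qed
  then show ?thesis using ts
    by (simp add: exp_minus exp_diff field_simps)
qed

lemma has_real_derivative_norm_sq:
  fixes x :: "real \<Rightarrow> 'a::real_inner"
  assumes "(x has_vector_derivative x') (at t)"
  shows "((\<lambda>t. (norm (x t))\<^sup>2) has_real_derivative 2 * (x' \<bullet> x t)) (at t)"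
proof -
  have "((\<lambda>t. x t \<bullet> x t) has_derivative (\<lambda>h. h *\<^sub>R (2 * (x' \<bullet> x t)))) (at t)"
    using assms unfolding has_vector_derivative_def
    by (auto intro!: derivative_eq_intros simp: inner_commute algebra_simps)
  then show ?thesis
    by (simp add: has_field_derivative_def power2_norm_eq_inner mult_commute_abs)
qed

text \<open>Gronwall is applied to the squared distance, which stays differentiable where the two
  solutions meet; this accounts for the constant 2 L inside the proof.\<close>

lemma lipschitz_solutions_gronwall:
  fixes F :: "'a::real_inner \<Rightarrow> 'a"
  assumes T: "is_interval T"
    and x: "\<And>t. t \<in> T \<Longrightarrow> (x has_vector_derivative F (x t)) (at t)"
    and y: "\<And>t. t \<in> T \<Longrightarrow> (y has_vector_derivative F (y t)) (at t)"
    and L: "\<And>t. t \<in> T \<Longrightarrow> norm (F (x t) - F (y t)) \<le> L * norm (x t - y t)"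
    and st: "s \<in> T" "t \<in> T"
  shows "norm (x t - y t) \<le> norm (x s - y s) * exp (L * \<bar>t - s\<bar>)"
proof -
  have "(norm (x t - y t))\<^sup>2 \<le> (norm (x s - y s))\<^sup>2 * exp ((2 * L) * \<bar>t - s\<bar>)"
  proof (rule gronwall[OF T _ _ st])
    fix r assume r: "r \<in> T"
    show "((\<lambda>t. (norm (x t - y t))\<^sup>2) has_real_derivative 2 * ((F (x r) - F (y r)) \<bullet> (x r - y r))) (at r)"
      by (intro has_real_derivative_norm_sq has_vector_derivative_diff x y r)
    have "\<bar>(F (x r) - F (y r)) \<bullet> (x r - y r)\<bar> \<le> norm (F (x r) - F (y r)) * norm (x r - y r)"
      by (rule Cauchy_Schwarz_ineq2)
    also have "\<dots> \<le> L * norm (x r - y r) * norm (x r - y r)"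
      by (intro mult_right_mono L r) auto
    finally show "\<bar>2 * ((F (x r) - F (y r)) \<bullet> (x r - y r))\<bar> \<le> 2 * L * (norm (x r - y r))\<^sup>2"
      by (simp add: abs_mult power2_eq_square)
  qed
  also have "\<dots> = (norm (x s - y s) * exp (L * \<bar>t - s\<bar>))\<^sup>2"
    by (simp add: power_mult_distrib exp_double[symmetric] mult.assoc)
  finally show ?thesis
    by (rule power2_le_imp_le) simp
qed

lemma solves_on_unique:
  fixes f :: "'a::real_inner \<Rightarrow> 'a"
  assumes lip: "\<And>R. \<exists>L. \<forall>x\<in>cball 0 R. \<forall>y\<in>cball 0 R. norm (f x - f y) \<le> L * norm (x - y)"
    and x: "solves_on f T x" and y: "solves_on f T' y"
    and s: "s \<in> T" "s \<in> T'" "x s = y s" and t: "t \<in> T" "t \<in> T'"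
  shows "x t = y t"
proof -
  \<comment> \<open>Between \<open>s\<close> and \<open>t\<close> both solutions have compact image,
    so a Lipschitz constant on a single ball suffices.\<close>
  define C where "C = {min s t..max s t}"
  have C: "C \<subseteq> T" "C \<subseteq> T'" "is_interval C" "s \<in> C" "t \<in> C"
    using x y s t unfolding C_def solves_on_def
    by (auto simp: is_interval_cc min_def max_def split: if_splits intro: mem_is_interval_1_I)
  have dx: "(x has_vector_derivative f (x t)) (at t)" and dy: "(y has_vector_derivative f (y t)) (at t)"
    if "t \<in> C" for t
    using x y C that unfolding solves_on_def by blast+
  have "compact (x ` C)" "compact (y ` C)"
    unfolding C_def
    by (intro compact_continuous_image compact_Icc continuous_at_imp_continuous_on;
        metis dx dy C_def has_vector_derivative_continuous)+
  then have "bounded (x ` C \<union> y ` C)"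
    by (simp add: compact_imp_bounded)
  then obtain R where R: "x ` C \<union> y ` C \<subseteq> cball 0 R"
    unfolding bounded_iff by (metis mem_cball_0 subsetI)
  obtain L where L: "\<forall>x\<in>cball 0 R. \<forall>y\<in>cball 0 R. norm (f x - f y) \<le> L * norm (x - y)"
    using lip by blast
  have "norm (x t - y t) \<le> norm (x s - y s) * exp (L * \<bar>t - s\<bar>)"
    by (rule lipschitz_solutions_gronwall[OF C(3) dx dy _ C(4,5)]) (use R L in blast)+
  then show ?thesis using s by simp
qed

text \<open>By uniqueness the two solutions agree on the overlap and glue to a solution on the
  union; maximality of \<open>T\<close> then absorbs \<open>J\<close>. In this way an arbitrary
  trajectory is identified with an explicitly known solution.\<close>

lemma trajectory_extends_solution:
  fixes f :: "'a::real_inner \<Rightarrow> 'a"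
  assumes lip: "\<And>R. \<exists>L. \<forall>x\<in>cball 0 R. \<forall>y\<in>cball 0 R. norm (f x - f y) \<le> L * norm (x - y)"
    and x: "trajectory f T x" and y: "solves_on f J y" and "x 0 = y 0"
  shows "J \<subseteq> T" and "\<And>t. t \<in> J \<Longrightarrow> x t = y t"
proof -
  have sx: "solves_on f T x" using x by (simp add: trajectory_def)
  have 0: "0 \<in> T" "0 \<in> J" using sx y by (auto simp: solves_on_def)
  have eq: "x t = y t" if "t \<in> T" "t \<in> J" for t
    by (rule solves_on_unique[OF lip sx y 0 \<open>x 0 = y 0\<close> that])
  define z where "z = (\<lambda>t. if t \<in> T then x t else y t)"
  have zy: "z t = y t" if "t \<in> J" for t using that eq by (simp add: z_def)
  have op: "open T" "open J" using sx y by (auto simp: solves_on_def)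
  have dx: "(x has_vector_derivative f (x t)) (at t)" if "t \<in> T" for t
    using sx that by (simp add: solves_on_def)
  have dy: "(y has_vector_derivative f (y t)) (at t)" if "t \<in> J" for t
    using y that by (simp add: solves_on_def)
  have "(z has_vector_derivative f (z t)) (at t)" if t: "t \<in> T \<union> J" for t
  proof (cases "t \<in> T")
    case True
    then have "(z has_vector_derivative f (x t)) (at t)"
      by (intro has_vector_derivative_transform_within_open[OF dx op(1)]) (simp_all add: z_def)
    then show ?thesis using True by (simp add: z_def)
  next
    case False
    then have "t \<in> J" using t by simp
    then have "(z has_vector_derivative f (y t)) (at t)"
      by (intro has_vector_derivative_transform_within_open[OF dy op(2)]) (simp_all add: zy)
    then show ?thesis using \<open>t \<in> J\<close> by (simp add: zy)
  qed
  moreover have "is_interval (T \<union> J)"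
  proof -
    have "connected (T \<union> J)"
      using sx y 0 by (intro connected_Un) (auto simp: solves_on_def is_interval_connected_1)
    then show ?thesis by (simp add: is_interval_connected_1)
  qed
  ultimately have "solves_on f (T \<union> J) z"
    using op 0 by (auto simp: solves_on_def)
  then have "T \<union> J = T"
    using x unfolding trajectory_def by (metis Un_upper1 z_def)
  then show J: "J \<subseteq> T" by blast
  show "x t = y t" if "t \<in> J" for t using eq J that by blast
qed

lemma antiderivative_real:
  fixes f :: "real \<Rightarrow> 'a::banach"
  assumes "continuous_on UNIV f"
  shows "\<exists>G. G 0 = 0 \<and> (\<forall>t. (G has_vector_derivative f t) (at t))"
proof -
  \<comment> \<open>For t of either sign at least one of the two integrals is over an empty interval
    or a single point and has the value 0, so \<open>G\<close> is the oriented integral from 0 to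
    t.\<close>
  define G where "G = (\<lambda>t. integral {0..t} f - integral {t..0} f)"
  have G': "(G has_vector_derivative f t) (at t)" for t
  proof -
    define N where "N = \<bar>t\<bar> + 1"
    have int: "f integrable_on {s..u}" for s u
      by (intro integrable_continuous_interval continuous_on_subset[OF assms]) auto
    have eq: "integral {-N..s} f - integral {-N..0} f = G s" if "s \<in> {-N<..<N}" for s
    proof (cases "0 \<le> s")
      case True
      then have "integral {-N..0} f + integral {0..s} f = integral {-N..s} f"
        by (intro Henstock_Kurzweil_Integration.integral_combine int) (auto simp: N_def)
      then show ?thesis using True by (cases "s = 0") (auto simp: G_def algebra_simps)
    next
      case False
      then have "integral {-N..s} f + integral {s..0} f = integral {-N..0} f"
        using that by (intro Henstock_Kurzweil_Integration.integral_combine int) (auto simp: N_def)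
      then show ?thesis using False by (auto simp: G_def algebra_simps)
    qed
    have "((\<lambda>s. integral {-N..s} f) has_vector_derivative f t) (at t within {-N..N})"
      by (rule integral_has_vector_derivative) (auto simp: N_def intro: continuous_on_subset[OF assms])
    then have "((\<lambda>s. integral {-N..s} f) has_vector_derivative f t) (at t)"
      by (subst (asm) at_within_interior) (auto simp: N_def)
    then have "((\<lambda>s. integral {-N..s} f - integral {-N..0} f) has_vector_derivative f t) (at t)"
      by (auto intro!: derivative_eq_intros)
    then show ?thesis
      by (rule has_vector_derivative_transform_within_open[of _ _ _ "{-N<..<N}"])
         (use eq in \<open>auto simp: N_def\<close>)
  qed
  show ?thesis
    by (intro exI[of _ G]) (use G' in \<open>simp add: G_def\<close>)
qed

text \<open>Integrating C exp(K s) gains the factor 1/K. This gain makes the Picard operator a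
  contraction in the weighted norm. Negative times follow by reflection.\<close>

lemma exponential_bound:
  fixes G :: "real \<Rightarrow> 'a::banach"
  assumes G: "\<And>t. (G has_vector_derivative g t) (at t)" "G 0 = 0"
    and g: "\<And>t. norm (g t) \<le> C * exp (K * \<bar>t\<bar>)" and "K > 0" "C \<ge> 0"
  shows "norm (G t) \<le> C / K * exp (K * \<bar>t\<bar>)"
proof -
  have pos: "norm (H t) \<le> C / K * exp (K * t)"
    if H: "\<And>t. (H has_vector_derivative h t) (at t)" "H 0 = 0" and "0 < t"
      and h: "\<And>t. norm (h t) \<le> C * exp (K * \<bar>t\<bar>)" for H h and t :: real
  proof -
    have "norm (H t - H 0) \<le> C / K * exp (K * t) - C / K * exp (K * 0)"
    proof (rule differentiable_bound_general[OF \<open>0 < t\<close>])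
      show "continuous_on {0..t} H"
        using H(1) by (intro continuous_at_imp_continuous_on) (blast intro: has_vector_derivative_continuous)
      show "continuous_on {0..t} (\<lambda>t. C / K * exp (K * t))" by (intro continuous_intros)
      show "(H has_vector_derivative h s) (at s)" for s by (rule H)
      show "((\<lambda>t. C / K * exp (K * t)) has_vector_derivative C * exp (K * s)) (at s)" for s
        using \<open>K > 0\<close> by (auto intro!: derivative_eq_intros simp: has_real_derivative_iff_has_vector_derivative[symmetric])
      show "norm (h s) \<le> C * exp (K * s)" if "0 < s" for s using h[of s] that by simp
    qed
    moreover have "C / K \<ge> 0" using \<open>K > 0\<close> \<open>C \<ge> 0\<close> by simp
    ultimately show ?thesis using H(2) by simp
  qed
  consider "t = 0" | "t > 0" | "t < 0" by linarith
  then show ?thesis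
  proof cases
    case 1 then show ?thesis using G(2) assms by simp
  next
    case 2 then show ?thesis using pos[OF G 2 g] by simp
  next
    case 3
    have "((\<lambda>t. G (- t)) has_vector_derivative - g (- t)) (at t)" for t
    proof -
      have "((\<lambda>t::real. - t) has_vector_derivative - 1) (at t)"
        by (auto intro!: derivative_eq_intros)
      from vector_diff_chain_at[OF this G(1)] show ?thesis by (simp add: o_def)
    qed
    moreover have "norm (- g (- t)) \<le> C * exp (K * \<bar>t\<bar>)" for t
      using g[of "- t"] by simp
    ultimately have "norm (G (- (- t))) \<le> C / K * exp (K * (- t))"
      using 3 G(2) by (intro pos) auto
    then show ?thesis using 3 by simp
  qed
qed

text \<open>Picard iteration, in the sup norm weighted by \<open>exp (- 2 L \<bar>t\<bar>)\<close>: there it is a contraction on the whole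
  line at once.\<close>

lemma global_solution_exists:
  fixes F :: "'a::banach \<Rightarrow> 'a"
  assumes lip0: "\<And>x y. norm (F x - F y) \<le> L0 * norm (x - y)"
  obtains X where "X 0 = x0" "\<And>t. (X has_vector_derivative F (X t)) (at t)"
proof -
  define L where "L = max L0 1"
  have "L > 0" by (simp add: L_def)
  have lip: "norm (F x - F y) \<le> L * norm (x - y)" for x y
    using lip0[of x y] mult_right_mono[of L0 L "norm (x - y)"] by (simp add: L_def)
  have contF: "continuous_on UNIV F"
    by (rule lipschitz_on_continuous_on[of L])
       (use lip \<open>L > 0\<close> in \<open>auto intro!: lipschitz_onI simp: dist_norm\<close>)
  define E where "E = (\<lambda>t::real. exp (2 * L * \<bar>t\<bar>))"
  have E: "E t > 0" "E t \<ge> 1" "continuous_on UNIV E" for t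
    using \<open>L > 0\<close> by (auto simp: E_def intro!: continuous_intros)
  \<comment> \<open>The unknown \<open>v\<close> stands for (X - x0) / E, which is bounded although
    X itself may grow exponentially; \<open>g v\<close> is then F along X.\<close>
  define g where "g = (\<lambda>(v::real \<Rightarrow>\<^sub>C 'a) t. F (x0 + E t *\<^sub>R v t))"
  have cont_g: "continuous_on UNIV (g v)" for v
    unfolding g_def
    by (intro continuous_on_compose2[OF contF] continuous_intros E) auto
  define G where "G = (\<lambda>v. SOME G. G 0 = 0 \<and> (\<forall>t. (G has_vector_derivative g v t) (at t)))"
  have G: "G v 0 = 0" "(G v has_vector_derivative g v t) (at t)" for v t
  proof -
    from someI_ex[OF antiderivative_real[OF cont_g[of v]]] show "G v 0 = 0" "(G v has_vector_derivative g v t) (at t)"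
      by (auto simp: G_def)
  qed
  have Gbound: "norm (G v t) \<le> (norm (F x0) + L * norm v) / (2 * L) * E t" for v t
    unfolding E_def
  proof (rule exponential_bound[OF G(2,1)])
    fix s
    have "norm (g v s) \<le> norm (F x0) + norm (F (x0 + E s *\<^sub>R v s) - F x0)"
      unfolding g_def by norm
    also have "\<dots> \<le> norm (F x0) + L * (E s * norm (v s))"
      using lip[of "x0 + E s *\<^sub>R v s" x0] E(1)[of s] by simp
    also have "\<dots> \<le> norm (F x0) * E s + L * (E s * norm v)"
      using E(1,2)[of s] \<open>L > 0\<close> norm_bounded[of v s]
      by (intro add_mono mult_left_mono) (auto simp: mult_left_le mult_le_cancel_left1)
    finally show "norm (g v s) \<le> (norm (F x0) + L * norm v) * exp (2 * L * \<bar>s\<bar>)"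
      by (simp add: algebra_simps E_def)
  qed (use \<open>L > 0\<close> in auto)
  \<comment> \<open>The weight grows at rate 2 L, twice the Lipschitz constant, and this produces
    the contraction factor 1/2.\<close>
  have Gdiff: "norm (G v t - G w t) \<le> (1/2 * dist v w) * E t" for v w t
  proof -
    have "norm (G v t - G w t) \<le> (L * dist v w) / (2 * L) * exp (2 * L * \<bar>t\<bar>)"
    proof (rule exponential_bound[where g="\<lambda>t. g v t - g w t"])
      fix s
      have "norm (g v s - g w s) \<le> L * (E s * norm (v s - w s))"
        using lip[of "x0 + E s *\<^sub>R v s" "x0 + E s *\<^sub>R w s"] E(1)[of s]
        by (simp add: g_def scaleR_diff_right[symmetric])
      also have "\<dots> \<le> L * (E s * dist v w)"
        using E(1)[of s] \<open>L > 0\<close> dist_bounded[of v s w] by (simp add: dist_norm)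
      finally show "norm (g v s - g w s) \<le> L * dist v w * exp (2 * L * \<bar>s\<bar>)"
        by (simp add: algebra_simps E_def)
    qed (use \<open>L > 0\<close> G in \<open>auto intro!: derivative_intros\<close>)
    then show ?thesis using \<open>L > 0\<close> by (simp add: E_def)
  qed
  \<comment> \<open>A fixed point satisfies E v = G v, so that x0 + G v has derivative F (x0 + G v).
    The bound \<open>Gbound\<close> guarantees that the argument of \<open>Bcontfun\<close> really
    is a bounded function.\<close>
  define K where "K = (\<lambda>v. Bcontfun (\<lambda>t. (1 / E t) *\<^sub>R G v t))"
  have K: "K v t = (1 / E t) *\<^sub>R G v t" for v t
  proof -
    have "continuous_on UNIV (G v)"
      using G(2) by (intro continuous_at_imp_continuous_on) (blast intro: has_vector_derivative_continuous)
    then have "continuous_on UNIV (\<lambda>t. (1 / E t) *\<^sub>R G v t)"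
      using E(1,3) by (intro continuous_intros) (auto simp: less_imp_neq[symmetric] dest: sym)
    moreover have "norm ((1 / E t) *\<^sub>R G v t) \<le> (norm (F x0) + L * norm v) / (2 * L)" for t
      using Gbound[of v t] E(1)[of t] by (simp add: field_simps)
    ultimately have "(\<lambda>t. (1 / E t) *\<^sub>R G v t) \<in> bcontfun"
      by (rule bcontfun_normI)
    then show ?thesis by (simp add: K_def Bcontfun_inverse)
  qed
  have "dist (K v) (K w) \<le> 1/2 * dist v w" for v w
  proof (rule dist_bound)
    fix t
    have "dist (K v t) (K w t) = 1 / E t * norm (G v t - G w t)"
      using E(1)[of t] by (simp add: K dist_norm scaleR_diff_right[symmetric])
    also have "\<dots> \<le> 1/2 * dist v w"
      using Gdiff[of v t w] E(1)[of t] by (simp add: field_simps)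
    finally show "dist (K v t) (K w t) \<le> 1/2 * dist v w" .
  qed
  then have "\<exists>!v. K v = v"
    by (intro banach_fix_type[of "1/2"]) auto
  then obtain v where v: "K v = v" by blast
  have gv: "g v t = F (x0 + G v t)" for t
    using K[of v t] E(1)[of t] by (simp add: v g_def)
  show thesis
  proof (rule that[of "\<lambda>t. x0 + G v t"])
    show "((\<lambda>t. x0 + G v t) has_vector_derivative F (x0 + G v t)) (at t)" for t
      using G(2)[of v t] gv[of t] by (auto intro!: derivative_eq_intros)
  qed (simp add: G)
qed

section \<open>Spheres contained in spheres\<close>

text \<open>If a point \<open>w\<close> were missed, stereographic projection would send the image
  into the hyperplane \<open>H\<close>. There it is open by invariance of domain and closed by
  compactness, hence all of \<open>H\<close>, so \<open>H\<close> is bounded.\<close>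

lemma sphere_embedding_surj:
  fixes f :: "'a::euclidean_space \<Rightarrow> 'a"
  assumes f: "continuous_on (sphere 0 1) f" "inj_on f (sphere 0 1)" "f ` sphere 0 1 \<subseteq> sphere 0 1"
  shows "f ` sphere 0 1 = sphere 0 1"
proof (rule ccontr)
  assume "f ` sphere 0 1 \<noteq> sphere 0 1"
  then obtain w where w: "norm w = 1" "w \<notin> f ` sphere 0 1" using f(3) by fastforce
  define H where "H = {x. w \<bullet> x = 0}"
  have "w \<noteq> 0" using w(1) by auto
  then have "sphere 0 1 - {w} homeomorphic H"
    unfolding H_def using w(1) by (intro homeomorphic_punctured_sphere_hyperplane) auto
  then obtain g g' where g: "homeomorphism (sphere 0 1 - {w}) H g g'"
    by (auto simp: homeomorphic_def)
  have fim: "f ` sphere 0 1 \<subseteq> sphere 0 1 - {w}" using f(3) w(2) by blast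
  have cont: "continuous_on (sphere 0 1) (g \<circ> f)"
    using g fim by (intro continuous_on_compose f) (auto simp: homeomorphism_def intro: continuous_on_subset)
  have "inj_on g (sphere 0 1 - {w})"
    using g by (metis homeomorphism_def inj_on_inverseI)
  then have inj: "inj_on (g \<circ> f) (sphere 0 1)"
    using f(2) fim by (intro comp_inj_on) (auto intro: inj_on_subset)
  have im: "(g \<circ> f) ` sphere 0 1 \<subseteq> H"
    using g fim by (auto simp: homeomorphism_def)
  have "openin (top_of_set H) ((g \<circ> f) ` sphere 0 1)"
  proof (rule invariance_of_domain_sphere_affine_set[OF cont inj, of _ 1 0])
    show "affine H" unfolding H_def by (rule affine_hyperplane)
    show "aff_dim H < int DIM('a)" using \<open>w \<noteq> 0\<close> by (simp add: H_def aff_dim_hyperplane)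
  qed (use im in auto)
  moreover have compact: "compact ((g \<circ> f) ` sphere 0 1)"
    by (intro compact_continuous_image cont compact_sphere)
  then have "closedin (top_of_set H) ((g \<circ> f) ` sphere 0 1)"
    using im by (simp add: closed_subset compact_imp_closed)
  moreover have "connected H"
    unfolding H_def by (intro convex_connected convex_hyperplane)
  moreover have ne: "w \<in> sphere 0 1" "- w \<in> sphere 0 1" using w(1) by auto
  ultimately have "(g \<circ> f) ` sphere 0 1 = H"
    by (metis connected_clopen empty_iff image_is_empty)
  then have "bounded H" using compact compact_imp_bounded by metis
  then obtain R where R: "\<And>x. x \<in> H \<Longrightarrow> norm x \<le> R"
    by (auto simp: bounded_iff)
  \<comment> \<open>A bounded linear subspace is {0}. The contradiction is then taken from
    injectivity at the two antipodal points \<open>w\<close> and \<open>- w\<close>, which also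
    covers dimension one, where \<open>H\<close> is {0} from the start.\<close>
  have H0: "x = 0" if "x \<in> H" for x
  proof (rule ccontr)
    assume "x \<noteq> 0"
    have "((\<bar>R\<bar> + 1) / norm x) *\<^sub>R x \<in> H" using that by (simp add: H_def)
    from R[OF this] show False using \<open>x \<noteq> 0\<close> by simp
  qed
  have "(g \<circ> f) w = (g \<circ> f) (- w)"
    using im ne H0 by (metis image_subset_iff)
  then have "w = - w" using inj ne by (metis inj_onD)
  then have "w \<bullet> w = - (w \<bullet> w)" by (metis inner_minus_right)
  then show False using \<open>w \<noteq> 0\<close> by simp
qed

lemma sphere_subset_sphere_eq:
  fixes S S' :: "'a::euclidean_space set"
  assumes "S homeomorphic sphere (0::'a) 1" "S' homeomorphic sphere (0::'a) 1" "S' \<subseteq> S"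
  shows "S' = S"
proof -
  obtain h k where h: "homeomorphism S (sphere (0::'a) 1) h k"
    using assms(1) by (auto simp: homeomorphic_def)
  obtain h' k' where h': "homeomorphism S' (sphere (0::'a) 1) h' k'"
    using assms(2) by (auto simp: homeomorphic_def)
  have k': "k' ` sphere 0 1 = S'" "continuous_on (sphere 0 1) k'" "inj_on k' (sphere 0 1)"
    using h' by (auto simp: homeomorphism_def intro: inj_on_inverseI)
  have hh: "h ` S = sphere 0 1" "continuous_on S h" "inj_on h S"
    using h by (auto simp: homeomorphism_def intro: inj_on_inverseI)
  have "(h \<circ> k') ` sphere 0 1 = sphere 0 1"
  proof (rule sphere_embedding_surj)
    show "continuous_on (sphere 0 1) (h \<circ> k')"
      by (rule continuous_on_compose[OF k'(2) continuous_on_subset[OF hh(2)]]) (use k'(1) assms(3) in simp)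
    show "inj_on (h \<circ> k') (sphere 0 1)"
      using k' hh assms(3) by (auto intro: comp_inj_on inj_on_subset)
    show "(h \<circ> k') ` sphere 0 1 \<subseteq> sphere 0 1"
      using k' hh assms(3) by (metis image_comp image_mono)
  qed
  then have "h ` S' = h ` S" using k'(1) hh(1) by (metis image_comp)
  then show ?thesis using hh(3) assms(3) by (meson inj_on_image_eq_iff subset_refl)
qed

section \<open>Homogeneous cubic fields pointing inwards\<close>

lemma norm_scaleR_sgn [simp]: "norm x *\<^sub>R sgn x = (x :: 'a::real_normed_vector)"
  by (cases "x = 0") (simp_all add: sgn_div_norm)

text \<open>These three properties are all that the dynamical argument uses of \<open>Q_N\<close>.
  The Lipschitz condition is asked on the unit ball only, since homogeneity spreads it to all
  balls.\<close>

locale dissipative_cubic =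
  fixes Q :: "'a::euclidean_space \<Rightarrow> 'a"
  assumes hom: "Q (r *\<^sub>R x) = r^3 *\<^sub>R Q x"
    and lipschitz_unit_ball: "\<exists>L. \<forall>x\<in>cball 0 1. \<forall>y\<in>cball 0 1. norm (Q x - Q y) \<le> L * norm (x - y)"
    and inner_neg: "x \<noteq> 0 \<Longrightarrow> Q x \<bullet> x < 0"
begin

lemma Q_0 [simp]: "Q 0 = 0"
  using hom[of 0 0] by simp

lemma lipschitz_ball: "\<exists>L. \<forall>x\<in>cball 0 R. \<forall>y\<in>cball 0 R. norm (Q x - Q y) \<le> L * norm (x - y)"
proof -
  obtain L where L: "\<forall>x\<in>cball 0 1. \<forall>y\<in>cball 0 1. norm (Q x - Q y) \<le> L * norm (x - y)"
    using lipschitz_unit_ball by blast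
  define S where "S = max R 1"
  have S: "S \<ge> 1" "S \<ge> R" by (auto simp: S_def)
  show ?thesis
  proof (intro exI ballI)
    fix x y :: 'a assume xy: "x \<in> cball 0 R" "y \<in> cball 0 R"
    have "Q x - Q y = S^3 *\<^sub>R (Q ((1/S) *\<^sub>R x) - Q ((1/S) *\<^sub>R y))"
      using S hom[of S "(1/S) *\<^sub>R x"] hom[of S "(1/S) *\<^sub>R y"] by (simp add: scaleR_diff_right)
    then have "norm (Q x - Q y) = S^3 * norm (Q ((1/S) *\<^sub>R x) - Q ((1/S) *\<^sub>R y))"
      using S by simp
    also have "\<dots> \<le> S^3 * (L * norm ((1/S) *\<^sub>R x - (1/S) *\<^sub>R y))"
      using L xy S by (intro mult_left_mono L[rule_format]) auto
    also have "\<dots> = (S^3 * L / S) * norm (x - y)"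
      using S by (simp add: scaleR_diff_right[symmetric])
    finally show "norm (Q x - Q y) \<le> (S^3 * L / S) * norm (x - y)" .
  qed
qed

lemma continuous_Q: "continuous_on UNIV Q"
proof (rule continuous_at_imp_continuous_on, rule ballI)
  fix x :: 'a
  obtain L where L: "\<forall>y\<in>cball 0 (norm x + 1). \<forall>z\<in>cball 0 (norm x + 1). norm (Q y - Q z) \<le> L * norm (y - z)"
    using lipschitz_ball by blast
  have "\<bar>L\<bar>-lipschitz_on (ball 0 (norm x + 1)) Q"
  proof (rule lipschitz_onI)
    fix y z :: 'a assume "y \<in> ball 0 (norm x + 1)" "z \<in> ball 0 (norm x + 1)"
    then have "norm (Q y - Q z) \<le> L * norm (y - z)" using L by simp
    also have "\<dots> \<le> \<bar>L\<bar> * norm (y - z)" by (intro mult_right_mono) auto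
    finally show "dist (Q y) (Q z) \<le> \<bar>L\<bar> * dist y z" by (simp add: dist_norm)
  qed auto
  then have "continuous_on (ball 0 (norm x + 1)) Q"
    using lipschitz_on_continuous_on by blast
  then show "isCont Q x"
    by (simp add: continuous_on_eq_continuous_at)
qed

text \<open>\<open>F x\<close> is \<open>Q x / (norm x)\<^sup>2\<close>: homogeneous of degree one, hence globally Lipschitz.\<close>

definition F :: "'a \<Rightarrow> 'a" where
  "F x = norm x *\<^sub>R Q (sgn x)"

lemma Q_eq_F: "Q x = (norm x)\<^sup>2 *\<^sub>R F x"
proof -
  have "Q x = Q (norm x *\<^sub>R sgn x)" by simp
  also have "\<dots> = (norm x)^3 *\<^sub>R Q (sgn x)" by (rule hom)
  finally show ?thesis by (simp add: F_def power3_eq_cube power2_eq_square)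
qed

lemma F_scaleR: "r > 0 \<Longrightarrow> F (r *\<^sub>R x) = r *\<^sub>R F x"
  by (simp add: F_def sgn_scaleR)

lemma F_inner: "F x \<bullet> x = (norm x)\<^sup>2 * (Q (sgn x) \<bullet> sgn x)"
proof -
  have "F x \<bullet> x = F x \<bullet> (norm x *\<^sub>R sgn x)" by simp
  then show ?thesis unfolding F_def inner_scaleR_left inner_scaleR_right by (simp add: power2_eq_square)
qed

text \<open>The direction \<open>sgn x\<close> is not Lipschitz near 0, but |x| |sgn x - sgn y| is
  at most 2 |x - y|, so the factor \<open>norm x\<close> in \<open>F\<close> compensates. The change
  of the factor itself contributes one more L, which gives 3 L.\<close>

lemma F_lipschitz: "\<exists>L. \<forall>x y. norm (F x - F y) \<le> L * norm (x - y)"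
proof -
  obtain L0 where L0: "\<forall>x\<in>cball 0 1. \<forall>y\<in>cball 0 1. norm (Q x - Q y) \<le> L0 * norm (x - y)"
    using lipschitz_unit_ball by blast
  define L where "L = max L0 0"
  have L: "norm (Q x - Q y) \<le> L * norm (x - y)" "L \<ge> 0" if "norm x \<le> 1" "norm y \<le> 1" for x y
    using L0[rule_format, of x y] that mult_right_mono[of L0 L "norm (x - y)"] by (auto simp: L_def)
  have sgn1: "norm (sgn x) \<le> 1" for x :: 'a by (simp add: norm_sgn)
  show ?thesis
  proof (intro exI allI)
    fix x y :: 'a
    have "norm x *\<^sub>R (sgn x - sgn y) = (x - y) - (norm x - norm y) *\<^sub>R sgn y"
      by (simp add: scaleR_diff_left scaleR_diff_right)
    then have "norm x * norm (sgn x - sgn y) = norm ((x - y) - (norm x - norm y) *\<^sub>R sgn y)"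
      by (metis abs_norm_cancel norm_scaleR)
    also have "\<dots> \<le> norm (x - y) + \<bar>norm x - norm y\<bar> * norm (sgn y)"
      by (metis norm_scaleR norm_triangle_ineq4)
    also have "\<dots> \<le> norm (x - y) + norm (x - y) * 1"
      using sgn1 by (intro add_mono mult_mono norm_triangle_ineq3) auto
    finally have s: "norm x * norm (sgn x - sgn y) \<le> 2 * norm (x - y)" by simp
    have "F x - F y = norm x *\<^sub>R (Q (sgn x) - Q (sgn y)) + (norm x - norm y) *\<^sub>R Q (sgn y)"
      by (simp add: F_def algebra_simps)
    then have "norm (F x - F y) \<le> norm x * norm (Q (sgn x) - Q (sgn y)) + \<bar>norm x - norm y\<bar> * norm (Q (sgn y))"
      by (metis abs_norm_cancel norm_scaleR norm_triangle_ineq)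
    also have "\<dots> \<le> norm x * (L * norm (sgn x - sgn y)) + norm (x - y) * (L * 1)"
    proof (intro add_mono mult_mono norm_triangle_ineq3)
      show "norm (Q (sgn x) - Q (sgn y)) \<le> L * norm (sgn x - sgn y)" by (rule L) (rule sgn1)+
      have "norm (Q (sgn y) - Q 0) \<le> L * norm (sgn y - 0)" by (rule L) (use sgn1 in auto)
      also have "\<dots> \<le> L * 1" using L(2)[of 0 0] sgn1 by (intro mult_left_mono) auto
      finally show "norm (Q (sgn y)) \<le> L * 1" by simp
    qed auto
    also have "\<dots> = L * (norm x * norm (sgn x - sgn y)) + L * norm (x - y)" by simp
    also have "\<dots> \<le> L * (2 * norm (x - y)) + L * norm (x - y)"
      using s L(2)[of 0 0] by (intro add_mono mult_left_mono) auto
    finally show "norm (F x - F y) \<le> (3 * L) * norm (x - y)" by simp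
  qed
qed

text \<open>The function F x . x is homogeneous of degree two, so its negative maximum over the
  compact unit sphere controls it everywhere.\<close>

lemma F_coercive: "\<exists>m>0. \<forall>x. F x \<bullet> x \<le> - m * (norm x)\<^sup>2"
proof -
  have "continuous_on (sphere 0 1) (\<lambda>u. Q u \<bullet> u)"
    by (intro continuous_intros continuous_on_subset[OF continuous_Q]) auto
  then have "\<exists>v\<in>sphere 0 1. \<forall>u\<in>sphere 0 1. Q u \<bullet> u \<le> Q v \<bullet> v"
    by (intro continuous_attains_sup) auto
  then obtain v where v: "v \<in> sphere 0 1" "\<And>u. u \<in> sphere 0 1 \<Longrightarrow> Q u \<bullet> u \<le> Q v \<bullet> v"
    by blast
  show ?thesis
  proof (intro exI conjI allI)
    show "- (Q v \<bullet> v) > 0" using inner_neg[of v] v(1) by (cases "v = 0") auto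
    fix x :: 'a
    have "(norm x)\<^sup>2 * (Q (sgn x) \<bullet> sgn x) \<le> (norm x)\<^sup>2 * (Q v \<bullet> v)"
      by (cases "x = 0") (auto intro!: mult_left_mono v(2) simp: norm_sgn)
    then show "F x \<bullet> x \<le> - (- (Q v \<bullet> v)) * (norm x)\<^sup>2" by (simp add: F_inner mult.commute)
  qed
qed

section \<open>The complete flow of the degree-one field\<close>

definition psi :: "'a \<Rightarrow> real \<Rightarrow> 'a" where
  "psi x = (SOME X. X 0 = x \<and> (\<forall>t. (X has_vector_derivative F (X t)) (at t)))"

lemma psi_0 [simp]: "psi x 0 = x"
  and psi_deriv: "(psi x has_vector_derivative F (psi x t)) (at t)"
proof -
  obtain L where "\<And>x y. norm (F x - F y) \<le> L * norm (x - y)" using F_lipschitz by blast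
  then have "\<exists>X. X 0 = x \<and> (\<forall>t. (X has_vector_derivative F (X t)) (at t))"
    using global_solution_exists[of F L x] by blast
  from someI_ex[OF this] show "psi x 0 = x" "(psi x has_vector_derivative F (psi x t)) (at t)"
    by (auto simp: psi_def)
qed

lemma psi_lipschitz: "\<exists>L. \<forall>x y t. norm (psi x t - psi y t) \<le> norm (x - y) * exp (L * \<bar>t\<bar>)"
proof -
  obtain L where L: "\<And>x y. norm (F x - F y) \<le> L * norm (x - y)" using F_lipschitz by blast
  have "norm (psi x t - psi y t) \<le> norm (psi x 0 - psi y 0) * exp (L * \<bar>t - 0\<bar>)" for x y t
    by (rule lipschitz_solutions_gronwall[of UNIV]) (auto intro: psi_deriv L)
  then show ?thesis by auto
qed

lemma psi_unique:
  assumes X: "\<And>t. (X has_vector_derivative F (X t)) (at t)"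
  shows "X t = psi (X 0) t"
proof -
  obtain L where L: "\<And>x y. norm (F x - F y) \<le> L * norm (x - y)" using F_lipschitz by blast
  have "norm (X t - psi (X 0) t) \<le> norm (X 0 - psi (X 0) 0) * exp (L * \<bar>t - 0\<bar>)"
    by (rule lipschitz_solutions_gronwall[of UNIV]) (auto intro: X psi_deriv L)
  then show ?thesis by simp
qed

lemma psi_add: "psi (psi x s) t = psi x (s + t)"
proof -
  have "((\<lambda>t. psi x (s + t)) has_vector_derivative F (psi x (s + t))) (at t)" for t
  proof -
    have "((\<lambda>t. s + t) has_vector_derivative 1) (at t)"
      by (auto intro!: derivative_eq_intros)
    from vector_diff_chain_at[OF this psi_deriv] show ?thesis by (simp add: o_def)
  qed
  from psi_unique[of "\<lambda>t. psi x (s + t)", OF this] show ?thesis by simp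
qed

lemma psi_scaleR:
  assumes "r > 0"
  shows "psi (r *\<^sub>R x) t = r *\<^sub>R psi x t"
proof -
  have "((\<lambda>t. r *\<^sub>R psi x t) has_vector_derivative F (r *\<^sub>R psi x t)) (at t)" for t
    unfolding F_scaleR[OF assms] by (auto intro!: derivative_eq_intros psi_deriv)
  from psi_unique[of "\<lambda>t. r *\<^sub>R psi x t", OF this] show ?thesis by simp
qed

lemma psi_nonzero:
  assumes "x \<noteq> 0"
  shows "psi x t \<noteq> 0"
proof
  assume "psi x t = 0"
  have "psi 0 s = 0" for s
    using psi_unique[of "\<lambda>_. 0" s] by (simp add: F_def)
  then have "psi (psi x t) (- t) = 0" using \<open>psi x t = 0\<close> by simp
  then show False using assms by (simp add: psi_add)
qed

lemma continuous_psi: "continuous_on UNIV (psi x)"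
  using psi_deriv by (intro continuous_at_imp_continuous_on) (blast intro: has_vector_derivative_continuous)

text \<open>The Lipschitz dependence on the initial point is locally uniform in time, so it combines
  with continuity in time alone. Joint continuity is needed to integrate along \<open>psi\<close>
  with the initial point as a parameter.\<close>

lemma continuous_psi_joint: "continuous_on UNIV (\<lambda>(x, t). psi x t)"
proof (rule continuous_at_imp_continuous_on, rule ballI)
  fix p :: "'a \<times> real"
  obtain x0 t0 where p: "p = (x0, t0)" by fastforce
  obtain L where L: "\<And>x y t. norm (psi x t - psi y t) \<le> norm (x - y) * exp (L * \<bar>t\<bar>)"
    using psi_lipschitz by blast
  have "((\<lambda>z. norm (fst z - x0) * exp (L * \<bar>snd z\<bar>)) \<longlongrightarrow> norm (x0 - x0) * exp (L * \<bar>t0\<bar>)) (at p)"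
    unfolding p by (intro tendsto_intros tendsto_eq_intros) auto
  then have lim: "((\<lambda>z. norm (fst z - x0) * exp (L * \<bar>snd z\<bar>)) \<longlongrightarrow> 0) (at p)" by simp
  have 1: "((\<lambda>z. psi (fst z) (snd z) - psi x0 (snd z)) \<longlongrightarrow> 0) (at p)"
    by (rule Lim_null_comparison[OF always_eventually lim]) (simp add: L)
  have "isCont (psi x0) (snd p)"
    using continuous_psi by (simp add: continuous_on_eq_continuous_at)
  then have "((\<lambda>z. psi x0 (snd z)) \<longlongrightarrow> psi x0 (snd p)) (at p)"
    by (rule isCont_tendsto_compose) (intro tendsto_intros)
  from tendsto_add[OF 1 this] show "isCont (\<lambda>(x, t). psi x t) p"
    by (simp add: isCont_def p case_prod_unfold)
qed

definition rate :: real where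
  "rate = (SOME m. m > 0 \<and> (\<forall>x. F x \<bullet> x \<le> - m * (norm x)\<^sup>2))"

lemma rate_pos: "rate > 0" and rate: "F x \<bullet> x \<le> - rate * (norm x)\<^sup>2"
  using someI_ex[OF F_coercive] by (auto simp: rate_def)

text \<open>Read backwards in time, this is exponential growth of the norm, which makes the integral
  of 1/|psi|^2 converge at minus infinity.\<close>

lemma psi_decay:
  assumes "s \<le> t"
  shows "(norm (psi x t))\<^sup>2 * exp (2 * rate * t) \<le> (norm (psi x s))\<^sup>2 * exp (2 * rate * s)"
proof (rule DERIV_nonpos_imp_nonincreasing[OF assms])
  fix r
  have e: "((\<lambda>t. exp (2 * rate * t)) has_real_derivative 2 * rate * exp (2 * rate * r)) (at r)"
    by (auto intro!: derivative_eq_intros)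
  show "\<exists>y. ((\<lambda>t. (norm (psi x t))\<^sup>2 * exp (2 * rate * t)) has_real_derivative y) (at r) \<and> y \<le> 0"
  proof (intro exI conjI)
    show "((\<lambda>t. (norm (psi x t))\<^sup>2 * exp (2 * rate * t)) has_real_derivative
       2 * (F (psi x r) \<bullet> psi x r + rate * (norm (psi x r))\<^sup>2) * exp (2 * rate * r)) (at r)"
      using DERIV_mult[OF has_real_derivative_norm_sq[OF psi_deriv] e] by (simp add: algebra_simps)
    have "2 * (F (psi x r) \<bullet> psi x r + rate * (norm (psi x r))\<^sup>2) \<le> 0"
      using rate[of "psi x r"] by simp
    then show "2 * (F (psi x r) \<bullet> psi x r + rate * (norm (psi x r))\<^sup>2) * exp (2 * rate * r) \<le> 0"
      by (rule mult_nonpos_nonneg) simp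
  qed
qed

text \<open>For a field of degree one the velocity of the direction depends on the direction only:
  F(p)/|p| is Q(sgn p), and differentiating 1/|p| subtracts its radial part. Hence the projected
  equation holds in the time of \<open>psi\<close> itself, without a change of clock.\<close>

lemma sgn_psi_deriv:
  assumes "x \<noteq> 0"
  shows "((\<lambda>t. sgn (psi x t)) has_vector_derivative projected_field Q (sgn (psi x t))) (at t)"
proof -
  have nz: "psi x s \<noteq> 0" for s using psi_nonzero[OF assms] .
  have "((\<lambda>t. sqrt ((norm (psi x t))\<^sup>2)) has_real_derivative
      (inverse (sqrt ((norm (psi x t))\<^sup>2)) / 2) * (2 * (F (psi x t) \<bullet> psi x t))) (at t)"
    using nz[of t] by (intro DERIV_chain2[OF DERIV_real_sqrt] has_real_derivative_norm_sq psi_deriv) simp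
  then have "((\<lambda>t. norm (psi x t)) has_real_derivative norm (psi x t) * (Q (sgn (psi x t)) \<bullet> sgn (psi x t))) (at t)"
    using nz[of t] by (simp add: F_inner power2_eq_square field_simps)
  then have "((\<lambda>t. inverse (norm (psi x t))) has_real_derivative
     - (norm (psi x t) * (Q (sgn (psi x t)) \<bullet> sgn (psi x t))) * inverse ((norm (psi x t))\<^sup>2)) (at t)"
    using nz[of t] by (auto intro!: derivative_eq_intros simp: power2_eq_square)
  note d = has_vector_derivative_scaleR[OF this psi_deriv[of x t]]
  define p n where "p = psi x t" and "n = norm p"
  have n: "n \<noteq> 0" "p = n *\<^sub>R sgn p" using nz[of t] by (auto simp: p_def n_def)
  define c where "c = - (n * (Q (sgn p) \<bullet> sgn p)) * inverse (n\<^sup>2)"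
  have "c *\<^sub>R p = (c * n) *\<^sub>R sgn p" by (metis n(2) scaleR_scaleR)
  moreover have "c * n = - (Q (sgn p) \<bullet> sgn p)"
    using n(1) by (simp add: c_def power2_eq_square)
  moreover have "inverse n *\<^sub>R F p = Q (sgn p)"
    using n(1) by (simp add: F_def n_def)
  ultimately have "inverse n *\<^sub>R F p + c *\<^sub>R p = projected_field Q (sgn p)"
    by (simp add: projected_field_def)
  with d show ?thesis
    unfolding sgn_div_norm[of "psi x _"] p_def[symmetric] n_def[symmetric] c_def[symmetric] by simp
qed

section \<open>Elapsed time and age\<close>

text \<open>Along \<open>psi\<close>, the time of the flow of \<open>Q\<close> elapses at the speed \<open>1 / (norm (psi x t))\<^sup>2\<close>.\<close>

definition elapsed :: "'a \<Rightarrow> real \<Rightarrow> real" where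
  "elapsed x = (SOME G. G 0 = 0 \<and> (\<forall>t. (G has_vector_derivative 1 / (norm (psi x t))\<^sup>2) (at t)))"

lemma elapsed_0: "x \<noteq> 0 \<Longrightarrow> elapsed x 0 = 0"
  and elapsed_deriv: "x \<noteq> 0 \<Longrightarrow> (elapsed x has_real_derivative 1 / (norm (psi x t))\<^sup>2) (at t)"
proof -
  assume x: "x \<noteq> 0"
  have "continuous_on UNIV (\<lambda>t. 1 / (norm (psi x t))\<^sup>2)"
    using psi_nonzero[OF x] by (intro continuous_intros continuous_psi) auto
  from someI_ex[OF antiderivative_real[OF this]]
  show "elapsed x 0 = 0" "(elapsed x has_real_derivative 1 / (norm (psi x t))\<^sup>2) (at t)"
    by (auto simp: elapsed_def has_real_derivative_iff_has_vector_derivative)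
qed

lemma elapsed_unique:
  assumes "x \<noteq> 0" "\<And>t. (G has_real_derivative 1 / (norm (psi x t))\<^sup>2) (at t)"
  shows "elapsed x t = G t - G 0"
proof -
  have "((\<lambda>t. elapsed x t - G t) has_real_derivative 0) (at t)" for t
    using DERIV_diff[OF elapsed_deriv[OF assms(1)] assms(2)] by simp
  from DERIV_isconst_all[OF allI, OF this] have "elapsed x t - G t = elapsed x 0 - G 0" by blast
  then show ?thesis using elapsed_0[OF assms(1)] by simp
qed

lemma elapsed_strict_mono:
  assumes "x \<noteq> 0" "s < t"
  shows "elapsed x s < elapsed x t"
  using assms by (intro DERIV_pos_imp_increasing[OF \<open>s < t\<close>]) (use elapsed_deriv psi_nonzero in \<open>force\<close>)

lemma elapsed_psi:
  assumes "x \<noteq> 0"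
  shows "elapsed (psi x s) t = elapsed x (s + t) - elapsed x s"
proof -
  have "((\<lambda>t. elapsed x (s + t)) has_real_derivative 1 / (norm (psi (psi x s) t))\<^sup>2) (at t)" for t
  proof -
    have "((\<lambda>t. s + t) has_real_derivative 1) (at t)"
      by (auto intro!: derivative_eq_intros)
    from DERIV_chain2[OF elapsed_deriv[OF assms] this] show ?thesis by (simp add: psi_add)
  qed
  from elapsed_unique[OF psi_nonzero[OF assms] this] show ?thesis by simp
qed

lemma elapsed_scaleR:
  assumes "x \<noteq> 0" "r > 0"
  shows "elapsed (r *\<^sub>R x) t = elapsed x t / r\<^sup>2"
proof -
  have "((\<lambda>t. elapsed x t / r\<^sup>2) has_real_derivative 1 / (norm (psi (r *\<^sub>R x) t))\<^sup>2) (at t)" for t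
    using DERIV_cdivide[OF elapsed_deriv[OF assms(1)], where c = "r\<^sup>2"] assms
    by (simp add: psi_scaleR power_mult_distrib mult.commute)
  from elapsed_unique[OF _ this] show ?thesis using assms by (simp add: elapsed_0)
qed

text \<open>For negative s the integrand is at most exp(2 rate s)/|x|^2 by \<open>psi_decay\<close>;
  the bound is minus the integral of this majorant over the negative half line.\<close>

lemma elapsed_lower:
  assumes "x \<noteq> 0"
  shows "elapsed x t \<ge> - 1 / (2 * rate * (norm x)\<^sup>2)"
proof (cases "t \<le> 0")
  case True
  define c where "c = 1 / (2 * rate * (norm x)\<^sup>2)"
  have "elapsed x 0 - c * exp (2 * rate * 0) \<le> elapsed x t - c * exp (2 * rate * t)"
  proof (rule DERIV_nonpos_imp_nonincreasing[OF True])
    fix s :: real assume "s \<le> 0"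
    have "1 / (norm (psi x s))\<^sup>2 \<le> exp (2 * rate * s) / (norm x)\<^sup>2"
      using psi_decay[OF \<open>s \<le> 0\<close>, of x] psi_nonzero[OF assms, of s] assms by (simp add: field_simps)
    moreover have "((\<lambda>t. elapsed x t - c * exp (2 * rate * t)) has_real_derivative
       1 / (norm (psi x s))\<^sup>2 - exp (2 * rate * s) / (norm x)\<^sup>2) (at s)"
    proof -
      have "((\<lambda>t. exp (2 * rate * t)) has_real_derivative 2 * rate * exp (2 * rate * s)) (at s)"
        by (auto intro!: derivative_eq_intros)
      from DERIV_diff[OF elapsed_deriv[OF assms] DERIV_cmult[OF this, of c]]
      show ?thesis using rate_pos by (simp add: c_def)
    qed
    ultimately show "\<exists>y. ((\<lambda>t. elapsed x t - c * exp (2 * rate * t)) has_real_derivative y) (at s) \<and> y \<le> 0"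
      by (intro exI[of _ "1 / (norm (psi x s))\<^sup>2 - exp (2 * rate * s) / (norm x)\<^sup>2"]) simp
  qed
  moreover have "c * exp (2 * rate * t) \<ge> 0" using rate_pos by (simp add: c_def)
  ultimately show ?thesis using elapsed_0[OF assms] by (simp add: c_def)
next
  case False
  then have "elapsed x t > 0" using elapsed_strict_mono[OF assms, of 0 t] elapsed_0[OF assms] by simp
  moreover have "- 1 / (2 * rate * (norm x)\<^sup>2) \<le> 0" using rate_pos by simp
  ultimately show ?thesis by linarith
qed

text \<open>The norm does not increase forwards, so the integrand stays above its initial value. The
  elapsed time is therefore unbounded above, which makes the age take arbitrarily large values along
  every orbit off 0.\<close>

lemma elapsed_upper:
  assumes "x \<noteq> 0" "t \<ge> 0"
  shows "elapsed x t \<ge> t / (norm x)\<^sup>2"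
proof -
  have "elapsed x 0 - 0 / (norm x)\<^sup>2 \<le> elapsed x t - t / (norm x)\<^sup>2"
  proof (rule DERIV_nonneg_imp_nondecreasing[OF assms(2)])
    fix s :: real assume "0 \<le> s"
    have "(norm (psi x s))\<^sup>2 \<le> (norm (psi x s))\<^sup>2 * exp (2 * rate * s)"
      using rate_pos \<open>0 \<le> s\<close> by (simp add: mult_le_cancel_left1)
    also have "\<dots> \<le> (norm x)\<^sup>2" using psi_decay[OF \<open>0 \<le> s\<close>, of x] by simp
    finally have "1 / (norm x)\<^sup>2 \<le> 1 / (norm (psi x s))\<^sup>2"
      using psi_nonzero[OF assms(1)] assms(1) by (intro divide_left_mono mult_pos_pos) auto
    moreover have "((\<lambda>t. elapsed x t - t / (norm x)\<^sup>2) has_real_derivative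
       1 / (norm (psi x s))\<^sup>2 - 1 / (norm x)\<^sup>2) (at s)"
      by (intro DERIV_diff elapsed_deriv assms DERIV_cdivide DERIV_ident)
    ultimately show "\<exists>y. ((\<lambda>t. elapsed x t - t / (norm x)\<^sup>2) has_real_derivative y) (at s) \<and> 0 \<le> y"
      by (intro exI[of _ "1 / (norm (psi x s))\<^sup>2 - 1 / (norm x)\<^sup>2"]) simp
  qed
  then show ?thesis using elapsed_0[OF assms(1)] by simp
qed

text \<open>The time the solution of \<open>x' = Q x\<close> through \<open>x\<close> has taken to come in from infinity.\<close>

definition age :: "'a \<Rightarrow> real" where
  "age x = - (INF t. elapsed x t)"

lemma bdd_below_elapsed: "x \<noteq> 0 \<Longrightarrow> bdd_below (range (elapsed x))"
  using elapsed_lower by (intro bdd_belowI2) auto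

text \<open>Monotonicity turns the infimum into a limit, through which the shift and scaling laws of
  \<open>elapsed\<close> pass to \<open>age\<close>.\<close>

lemma elapsed_tendsto:
  assumes "x \<noteq> 0"
  shows "(elapsed x \<longlongrightarrow> - age x) at_bot"
proof (rule decreasing_tendsto)
  show "\<forall>\<^sub>F t in at_bot. - age x \<le> elapsed x t"
    using bdd_below_elapsed[OF assms] by (auto simp: age_def intro!: always_eventually cINF_lower)
  fix c assume "- age x < c"
  then obtain s where s: "elapsed x s < c"
    using bdd_below_elapsed[OF assms] by (auto simp: age_def cInf_less_iff)
  show "\<forall>\<^sub>F t in at_bot. elapsed x t < c"
    using eventually_le_at_bot[of s]
  proof eventually_elim
    case (elim t)
    then show ?case using s elapsed_strict_mono[OF assms, of t s] by (cases "t = s") auto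
  qed
qed

lemma age_psi:
  assumes "x \<noteq> 0"
  shows "age (psi x s) = age x + elapsed x s"
proof -
  have "filterlim (\<lambda>t. s + t) at_bot at_bot"
    unfolding filterlim_at_bot
  proof
    show "\<forall>\<^sub>F t in at_bot. s + t \<le> Z" for Z
      by (rule eventually_mono[OF eventually_le_at_bot[of "Z - s"]]) simp
  qed
  then have "((\<lambda>t. elapsed x (s + t) - elapsed x s) \<longlongrightarrow> - age x - elapsed x s) at_bot"
    by (intro tendsto_diff tendsto_const filterlim_compose[OF elapsed_tendsto[OF assms]])
  moreover have "((\<lambda>t. elapsed x (s + t) - elapsed x s) \<longlongrightarrow> - age (psi x s)) at_bot"
    using elapsed_tendsto[OF psi_nonzero[OF assms], of s] unfolding elapsed_psi[OF assms, abs_def] .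
  ultimately have "- age x - elapsed x s = - age (psi x s)"
    by (rule tendsto_unique[rotated]) simp
  then show ?thesis by simp
qed

lemma age_scaleR:
  assumes "x \<noteq> 0" "r > 0"
  shows "age (r *\<^sub>R x) = age x / r\<^sup>2"
proof -
  have "((\<lambda>t. elapsed x t / r\<^sup>2) \<longlongrightarrow> - age x / r\<^sup>2) at_bot"
    using assms by (intro tendsto_divide tendsto_const elapsed_tendsto) auto
  moreover have "((\<lambda>t. elapsed x t / r\<^sup>2) \<longlongrightarrow> - age (r *\<^sub>R x)) at_bot"
    using elapsed_tendsto[of "r *\<^sub>R x"] assms
    unfolding elapsed_scaleR[OF assms, abs_def, symmetric] by simp
  ultimately have "- age x / r\<^sup>2 = - age (r *\<^sub>R x)"
    by (rule tendsto_unique[rotated]) simp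
  then show ?thesis by simp
qed

lemma age_pos:
  assumes "x \<noteq> 0"
  shows "age x > 0"
proof -
  have "- age x \<le> elapsed x (-1)"
    using bdd_below_elapsed[OF assms] by (auto simp: age_def intro!: cINF_lower)
  also have "\<dots> < 0" using elapsed_strict_mono[OF assms, of "-1" 0] elapsed_0[OF assms] by simp
  finally show ?thesis by simp
qed

lemma age_le:
  assumes "x \<noteq> 0"
  shows "age x \<le> 1 / (2 * rate * (norm x)\<^sup>2)"
proof -
  have "- 1 / (2 * rate * (norm x)\<^sup>2) \<le> (INF t. elapsed x t)"
    using elapsed_lower[OF assms] by (intro cINF_greatest) auto
  then show ?thesis by (simp add: age_def)
qed

text \<open>The age of psi u t is the tail of the integral that defines the age of \<open>u\<close>;
  the bound does not depend on \<open>u\<close>.\<close>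

lemma age_psi_le:
  assumes "norm u = 1" "t \<le> 0"
  shows "age (psi u t) \<le> exp (2 * rate * t) / (2 * rate)"
proof -
  have u: "u \<noteq> 0" using assms by auto
  have "1 / (norm (psi u t))\<^sup>2 \<le> exp (2 * rate * t)"
    using psi_decay[OF assms(2), of u] psi_nonzero[OF u, of t] assms by (simp add: field_simps)
  then have "1 / (norm (psi u t))\<^sup>2 / (2 * rate) \<le> exp (2 * rate * t) / (2 * rate)"
    using rate_pos by (intro divide_right_mono) auto
  then show ?thesis using age_le[OF psi_nonzero[OF u], of t] by (simp add: mult.commute)
qed

lemma continuous_elapsed: "continuous_on (sphere 0 1) (\<lambda>u. elapsed u (- real n))"
proof -
  have "continuous_on (sphere 0 1 \<times> cbox (- real n) 0) (\<lambda>(u, t). 1 / (norm (psi u t))\<^sup>2)"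
  proof -
    have "continuous_on (sphere 0 1 \<times> cbox (- real n) 0) (\<lambda>(u, t). psi u t)"
      by (rule continuous_on_subset[OF continuous_psi_joint]) auto
    moreover have "psi u t \<noteq> 0" if "norm u = 1" for u t
      using psi_nonzero[of u t] that by (cases "u = 0") auto
    ultimately show ?thesis
      unfolding case_prod_unfold by (intro continuous_intros) auto
  qed
  then have "continuous_on (sphere 0 1) (\<lambda>u. integral (cbox (- real n) 0) (\<lambda>t. 1 / (norm (psi u t))\<^sup>2))"
    by (rule integral_continuous_on_param)
  then have "continuous_on (sphere 0 1) (\<lambda>u. - integral {- real n..0} (\<lambda>t. 1 / (norm (psi u t))\<^sup>2))"
    by (auto intro: continuous_intros)
  then show ?thesis
  proof (rule continuous_on_eq)
    fix u :: 'a assume "u \<in> sphere 0 1"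
    then have u: "u \<noteq> 0" by auto
    have "((\<lambda>t. 1 / (norm (psi u t))\<^sup>2) has_integral elapsed u 0 - elapsed u (- real n)) {- real n..0}"
      using elapsed_deriv[OF u]
      by (intro fundamental_theorem_of_calculus)
         (auto simp: has_real_derivative_iff_has_vector_derivative intro: has_vector_derivative_at_within)
    then show "- integral {- real n..0} (\<lambda>t. 1 / (norm (psi u t))\<^sup>2) = elapsed u (- real n)"
      by (simp add: integral_unique elapsed_0[OF u])
  qed
qed

text \<open>Cutting the integral at -n leaves the remainder age(psi u (-n)), which is uniformly
  small on the sphere, so \<open>age\<close> is a uniform limit of continuous functions.\<close>

lemma continuous_age: "continuous_on (sphere 0 1) age"
proof (rule uniform_limit_theorem)
  show "\<forall>\<^sub>F n in sequentially. continuous_on (sphere 0 1) (\<lambda>u. - elapsed u (- real n))"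
    by (intro always_eventually allI continuous_intros continuous_elapsed)
  show "uniform_limit (sphere 0 1) (\<lambda>n u. - elapsed u (- real n)) age sequentially"
  proof (rule uniform_limitI)
    fix \<epsilon> :: real assume "\<epsilon> > 0"
    have "(\<lambda>n. exp (2 * rate * (- real n)) / (2 * rate)) \<longlonglongrightarrow> 0"
    proof -
      have "filterlim (\<lambda>n. 2 * rate * real n) at_top sequentially"
        using rate_pos by (intro filterlim_tendsto_pos_mult_at_top[OF tendsto_const] filterlim_real_sequentially) auto
      then have "filterlim (\<lambda>n. 2 * rate * (- real n)) at_bot sequentially"
        by (simp add: filterlim_uminus_at_bot)
      then have "(\<lambda>n. exp (2 * rate * (- real n))) \<longlonglongrightarrow> 0"
        by (rule filterlim_compose[OF exp_at_bot])
      from tendsto_divide[OF this tendsto_const, of "2 * rate"] show ?thesis using rate_pos by simp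
    qed
    then have "\<forall>\<^sub>F n in sequentially. exp (2 * rate * (- real n)) / (2 * rate) < \<epsilon>"
      using \<open>\<epsilon> > 0\<close> by (rule order_tendstoD)
    then show "\<forall>\<^sub>F n in sequentially. \<forall>u\<in>sphere 0 1. dist (- elapsed u (- real n)) (age u) < \<epsilon>"
    proof eventually_elim
      case (elim n)
      show ?case
      proof
        fix u :: 'a assume "u \<in> sphere 0 1"
        then have u: "norm u = 1" "u \<noteq> 0" by auto
        have "0 < age (psi u (- real n))" using age_pos psi_nonzero[OF u(2)] by blast
        moreover have "age (psi u (- real n)) < \<epsilon>" using age_psi_le[OF u(1), of "- real n"] elim by simp
        ultimately show "dist (- elapsed u (- real n)) (age u) < \<epsilon>"
          using age_psi[OF u(2), of "- real n"] by (simp add: dist_real_def)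
      qed
    qed
  qed
qed simp

text \<open>The product of \<open>age x\<close> with |x|^2 is homogeneous of degree 0, so its
  minimum over the unit sphere serves as \<open>c\<close>. Together with \<open>age_le\<close> this
  makes small age equivalent to large norm, quantitatively.\<close>

lemma age_ge: "\<exists>c>0. \<forall>x. x \<noteq> 0 \<longrightarrow> age x \<ge> c / (norm x)\<^sup>2"
proof -
  have "\<exists>v\<in>sphere 0 1. \<forall>u\<in>sphere 0 1. age v \<le> age u"
    by (intro continuous_attains_inf continuous_age) auto
  then obtain v where v: "v \<in> sphere 0 1" "\<And>u. u \<in> sphere 0 1 \<Longrightarrow> age v \<le> age u"
    by blast
  show ?thesis
  proof (intro exI conjI allI impI)
    show "age v > 0" using v by (intro age_pos) auto
    fix x :: 'a assume x: "x \<noteq> 0"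
    have "age x = age (norm x *\<^sub>R sgn x)" by simp
    also have "\<dots> = age (sgn x) / (norm x)\<^sup>2" using x by (intro age_scaleR) (auto simp: sgn_zero_iff)
    also have "\<dots> \<ge> age v / (norm x)\<^sup>2" using x by (intro divide_right_mono v) (auto simp: norm_sgn)
    finally show "age v / (norm x)\<^sup>2 \<le> age x" .
  qed
qed

lemma age_psi_deriv:
  assumes "x \<noteq> 0"
  shows "((\<lambda>t. age (psi x t)) has_real_derivative 1 / (norm (psi x t))\<^sup>2) (at t)"
  unfolding age_psi[OF assms]
  using DERIV_add[OF DERIV_const elapsed_deriv[OF assms]] by simp

lemma age_psi_surj:
  assumes "x \<noteq> 0" "s > 0"
  shows "s \<in> range (\<lambda>t. age (psi x t))"
proof -
  have "((\<lambda>t. age x + elapsed x t) \<longlongrightarrow> age x + - age x) at_bot"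
    by (intro tendsto_add tendsto_const elapsed_tendsto assms)
  then have "\<forall>\<^sub>F t in at_bot. age x + elapsed x t < s"
    using assms(2) by (intro order_tendstoD) auto
  then obtain t1 where "age x + elapsed x t1 < s"
    by (metis eventually_at_bot_linorder order_refl)
  then have 1: "age (psi x t1) < s" by (simp add: age_psi assms)
  \<comment> \<open>By \<open>elapsed_upper\<close> this much time along \<open>psi\<close> adds at
    least \<open>s\<close> to the age, which is positive at the start.\<close>
  define t2 where "t2 = s * (norm x)\<^sup>2"
  have "elapsed x t2 \<ge> s"
    using elapsed_upper[of x t2] assms by (simp add: t2_def)
  then have 2: "s < age (psi x t2)" using age_pos[OF assms(1)] by (simp add: age_psi assms)
  have "connected (range (\<lambda>t. age (psi x t)))"
    by (intro connected_continuous_image continuous_at_imp_continuous_on ballI DERIV_isCont[OF age_psi_deriv] assms connected_UNIV)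
  from connectedD_interval[OF this, of "age (psi x t1)" "age (psi x t2)" s] show ?thesis using 1 2 by auto
qed

section \<open>Orbits parametrised by age, and the solutions of x' = lam x + Q(x)\<close>

definition clock :: "'a \<Rightarrow> real \<Rightarrow> real" where
  "clock x = inv (\<lambda>t. age (psi x t))"

lemma age_psi_clock: "x \<noteq> 0 \<Longrightarrow> s > 0 \<Longrightarrow> age (psi x (clock x s)) = s"
  unfolding clock_def using f_inv_into_f[OF age_psi_surj] .

lemma clock_age_psi:
  assumes "x \<noteq> 0"
  shows "clock x (age (psi x t)) = t"
proof -
  have "inj (\<lambda>t. age (psi x t))"
    unfolding age_psi[OF assms] using elapsed_strict_mono[OF assms]
    by (intro strict_mono_imp_inj_on) (auto simp: strict_mono_def)
  then show ?thesis unfolding clock_def by (rule inv_f_f)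
qed

lemma clock_strict_mono:
  assumes "x \<noteq> 0" "0 < s" "s < t"
  shows "clock x s < clock x t"
proof (rule ccontr)
  assume "\<not> clock x s < clock x t"
  then have "elapsed x (clock x t) \<le> elapsed x (clock x s)"
    using elapsed_strict_mono[OF assms(1), of "clock x t" "clock x s"] by (cases "clock x t = clock x s") auto
  then show False
    using age_psi_clock[OF assms(1), of s] age_psi_clock[OF assms(1), of t] assms
    by (simp add: age_psi)
qed

text \<open>This factor turns the velocity F p of \<open>psi\<close> into |p|^2 F p = Q p:
  parametrised by age, the orbit solves x' = Q(x). Only positive ages occur on an orbit, so nothing
  is claimed about \<open>clock\<close> elsewhere.\<close>

lemma clock_deriv:
  assumes x: "x \<noteq> 0" and s: "s > 0"
  shows "(clock x has_real_derivative (norm (psi x (clock x s)))\<^sup>2) (at s)"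
proof -
  have "(clock x has_real_derivative inverse (1 / (norm (psi x (clock x s)))\<^sup>2)) (at s)"
  proof (rule DERIV_inverse_function[where f="\<lambda>t. age (psi x t)" and a=0 and b="s + 1"])
    show "((\<lambda>t. age (psi x t)) has_real_derivative 1 / (norm (psi x (clock x s)))\<^sup>2) (at (clock x s))"
      by (rule age_psi_deriv[OF x])
    have "isCont (clock x) (age (psi x (clock x s)))"
      by (rule isCont_inverse_function[where d=1 and f="\<lambda>t. age (psi x t)"])
         (auto intro: clock_age_psi[OF x] DERIV_isCont[OF age_psi_deriv[OF x]])
    then show "isCont (clock x) s" by (simp add: age_psi_clock x s)
  qed (use psi_nonzero[OF x] s age_psi_clock[OF x] in auto)
  then show ?thesis by simp
qed

text \<open>The added term is the integral of exp(2 lam r) from 0 to t, the time spent under Q. The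
  value is the age of the point before it is stretched by exp(lam t).\<close>

definition aged :: "real \<Rightarrow> 'a \<Rightarrow> real \<Rightarrow> real" where
  "aged lam x t = age x + (exp (2 * lam * t) - 1) / (2 * lam)"

definition sol :: "real \<Rightarrow> 'a \<Rightarrow> real \<Rightarrow> 'a" where
  "sol lam x t = exp (lam * t) *\<^sub>R psi x (clock x (aged lam x t))"

text \<open>Age 0 corresponds to infinity, so for positive \<open>lam\<close> positivity of the age
  marks the interval of existence of \<open>sol\<close>; \<open>trajectory_sol\<close> shows that it
  is maximal.\<close>

definition dom :: "real \<Rightarrow> 'a \<Rightarrow> real set" where
  "dom lam x = {t. aged lam x t > 0}"

abbreviation field :: "real \<Rightarrow> 'a \<Rightarrow> 'a" where
  "field lam x \<equiv> lam *\<^sub>R x + Q x"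

lemma aged_mono: "lam > 0 \<Longrightarrow> s \<le> t \<Longrightarrow> aged lam x s \<le> aged lam x t"
  by (simp add: aged_def divide_right_mono)

lemma aged_0 [simp]: "aged lam x 0 = age x"
  by (simp add: aged_def)

lemma continuous_aged [continuous_intros]: "continuous_on A (aged lam x)"
  unfolding aged_def by (cases "lam = 0") (auto intro!: continuous_intros)

lemma sol_0 [simp]: "x \<noteq> 0 \<Longrightarrow> sol lam x 0 = x"
  using clock_age_psi[of x 0] by (simp add: sol_def)

lemma sol_nonzero: "x \<noteq> 0 \<Longrightarrow> sol lam x t \<noteq> 0"
  by (simp add: sol_def psi_nonzero)

lemma age_sol:
  assumes "x \<noteq> 0" "t \<in> dom lam x"
  shows "age (sol lam x t) = exp (- 2 * lam * t) * aged lam x t"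
proof -
  have "age (sol lam x t) = aged lam x t / (exp (lam * t))\<^sup>2"
    using assms by (simp add: sol_def age_scaleR psi_nonzero age_psi_clock dom_def)
  also have "(exp (lam * t))\<^sup>2 = exp (2 * lam * t)" by (simp add: exp_double[symmetric] mult.assoc)
  finally show ?thesis by (simp add: exp_minus divide_inverse mult.commute)
qed

lemma age_sol_eq:
  assumes "x \<noteq> 0" "lam > 0" "t \<in> dom lam x"
  shows "age (sol lam x t) = exp (- 2 * lam * t) * (age x - 1 / (2 * lam)) + 1 / (2 * lam)"
proof -
  have "exp (- 2 * lam * t) * exp (2 * lam * t) = 1" by (simp add: exp_add[symmetric])
  then show ?thesis
    unfolding age_sol[OF assms(1,3)] aged_def by (simp add: algebra_simps diff_divide_distrib)
qed

lemma sol_deriv: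
  assumes x: "x \<noteq> 0" and lam: "lam > 0" and t: "t \<in> dom lam x"
  shows "(sol lam x has_vector_derivative field lam (sol lam x t)) (at t)"
proof -
  define p where "p = psi x (clock x (aged lam x t))"
  define e where "e = exp (lam * t)"
  have e2: "exp (2 * lam * t) = e\<^sup>2" by (simp add: e_def exp_double[symmetric] mult.assoc)
  have "(aged lam x has_real_derivative e\<^sup>2) (at t)"
    unfolding aged_def e2[symmetric] using lam by (auto intro!: derivative_eq_intros)
  moreover have "(clock x has_real_derivative (norm p)\<^sup>2) (at (aged lam x t))"
    unfolding p_def using t by (intro clock_deriv x) (simp add: dom_def)
  ultimately have "((\<lambda>t. clock x (aged lam x t)) has_real_derivative (norm p)\<^sup>2 * e\<^sup>2) (at t)"
    by (rule DERIV_chain2[rotated])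
  then have "((\<lambda>t. clock x (aged lam x t)) has_vector_derivative (norm p)\<^sup>2 * e\<^sup>2) (at t)"
    by (simp add: has_real_derivative_iff_has_vector_derivative)
  from vector_diff_chain_at[OF this psi_deriv]
  have psi': "((\<lambda>t. psi x (clock x (aged lam x t))) has_vector_derivative ((norm p)\<^sup>2 * e\<^sup>2) *\<^sub>R F p) (at t)"
    by (simp add: o_def p_def)
  have "((\<lambda>t. exp (lam * t)) has_real_derivative lam * e) (at t)"
    unfolding e_def by (auto intro!: derivative_eq_intros)
  from has_vector_derivative_scaleR[OF this psi']
  have "(sol lam x has_vector_derivative e *\<^sub>R (((norm p)\<^sup>2 * e\<^sup>2) *\<^sub>R F p) + (lam * e) *\<^sub>R p) (at t)"
    by (simp add: sol_def[abs_def] p_def e_def)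
  moreover have "sol lam x t = e *\<^sub>R p" by (simp add: sol_def p_def e_def)
  moreover have "Q (e *\<^sub>R p) = e *\<^sub>R (((norm p)\<^sup>2 * e\<^sup>2) *\<^sub>R F p)"
    unfolding hom Q_eq_F[of p] by (simp add: power3_eq_cube power2_eq_square mult_ac)
  ultimately show ?thesis by (simp add: add.commute)
qed

lemma solves_on_sol:
  assumes "x \<noteq> 0" "lam > 0"
  shows "solves_on (field lam) (dom lam x) (sol lam x)"
  unfolding solves_on_def
proof (intro conjI ballI)
  show "open (dom lam x)"
    unfolding dom_def by (intro open_Collect_less continuous_intros)
  show "is_interval (dom lam x)"
    unfolding is_interval_1 dom_def using aged_mono[OF assms(2)] by (auto intro: less_le_trans)
  show "0 \<in> dom lam x" using age_pos[OF assms(1)] by (simp add: dom_def)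
qed (rule sol_deriv[OF assms])

lemma field_lipschitz: "\<exists>L. \<forall>x\<in>cball 0 R. \<forall>y\<in>cball 0 R. norm (field lam x - field lam y) \<le> L * norm (x - y)"
proof -
  obtain L where L: "\<forall>x\<in>cball 0 R. \<forall>y\<in>cball 0 R. norm (Q x - Q y) \<le> L * norm (x - y)"
    using lipschitz_ball by blast
  show ?thesis
  proof (intro exI ballI)
    fix x y :: 'a assume xy: "x \<in> cball 0 R" "y \<in> cball 0 R"
    have "field lam x - field lam y = lam *\<^sub>R (x - y) + (Q x - Q y)" by (simp add: algebra_simps)
    then have "norm (field lam x - field lam y) \<le> \<bar>lam\<bar> * norm (x - y) + norm (Q x - Q y)"
      by (metis norm_scaleR norm_triangle_ineq)
    also have "\<dots> \<le> \<bar>lam\<bar> * norm (x - y) + L * norm (x - y)" using L xy by simp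
    finally show "norm (field lam x - field lam y) \<le> (\<bar>lam\<bar> + L) * norm (x - y)" by (simp add: algebra_simps)
  qed
qed

text \<open>At a finite left end of \<open>dom lam x\<close> the age of the solution tends to \<open>0\<close>, so the solution blows up there.\<close>

lemma trajectory_sol:
  assumes x: "x \<noteq> 0" and lam: "lam > 0"
  shows "trajectory (field lam) (dom lam x) (sol lam x)"
  unfolding trajectory_def
proof (intro conjI allI impI)
  show "solves_on (field lam) (dom lam x) (sol lam x)" by (rule solves_on_sol[OF assms])
  fix T' y
  assume "solves_on (field lam) T' y \<and> dom lam x \<subseteq> T' \<and> (\<forall>t\<in>dom lam x. y t = sol lam x t)"
  then have y: "solves_on (field lam) T' y" "dom lam x \<subseteq> T'" "\<And>t. t \<in> dom lam x \<Longrightarrow> y t = sol lam x t"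
    by auto
  show "T' = dom lam x"
  proof (rule ccontr)
    assume "T' \<noteq> dom lam x"
    then obtain t1 where "t1 \<in> T'" "t1 \<notin> dom lam x" using y(2) by blast
    then have t1: "t1 \<in> T'" "aged lam x t1 \<le> 0" by (simp_all add: dom_def)
    have age0: "aged lam x 0 > 0" using age_pos[OF x] by simp
    then have "t1 \<le> 0" using t1(2) aged_mono[OF lam, of 0 t1 x] by linarith
    obtain r where r: "t1 \<le> r" "r \<le> 0" "aged lam x r = 0"
      using IVT'[of "aged lam x" t1 0 0] t1(2) age0 \<open>t1 \<le> 0\<close> continuous_aged by (metis less_imp_le)
    have "r \<in> T'"
      using r t1(1) y(1) unfolding solves_on_def by (meson mem_is_interval_1_I)
    have "isCont y r"
      using y(1) \<open>r \<in> T'\<close> unfolding solves_on_def by (meson has_vector_derivative_continuous)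
    then have "(y \<longlongrightarrow> y r) (at_right r)"
      by (simp add: isCont_def filterlim_at_split)
    moreover have "(aged lam x \<longlongrightarrow> aged lam x r) (at_right r)"
      using continuous_aged[of UNIV lam x] by (auto simp: continuous_on_def intro: tendsto_within_subset)
    ultimately have "((\<lambda>t. exp (- 2 * lam * t) * aged lam x t * (norm (y t))\<^sup>2) \<longlongrightarrow>
        exp (- 2 * lam * r) * aged lam x r * (norm (y r))\<^sup>2) (at_right r)"
      by (intro tendsto_intros)
    then have lim: "((\<lambda>t. exp (- 2 * lam * t) * aged lam x t * (norm (y t))\<^sup>2) \<longlongrightarrow> 0) (at_right r)"
      using r(3) by simp
    \<comment> \<open>The displayed product is age(y t) |y t|^2. Continuity of \<open>y\<close> at
      \<open>r\<close> drives it to 0, while \<open>age_ge\<close> keeps it above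
      \<open>c\<close>.\<close>
    obtain c where c: "c > 0" "\<And>x. x \<noteq> 0 \<Longrightarrow> age x \<ge> c / (norm x)\<^sup>2" using age_ge by blast
    have "\<forall>\<^sub>F t in at_right r. c \<le> exp (- 2 * lam * t) * aged lam x t * (norm (y t))\<^sup>2"
    proof (rule eventually_at_rightI[of r "r + 1"])
      fix t assume "t \<in> {r<..<r + 1}"
      then have "exp (2 * lam * r) < exp (2 * lam * t)" using lam by simp
      then have "aged lam x r < aged lam x t"
        using lam by (simp add: aged_def divide_strict_right_mono)
      then have t: "t \<in> dom lam x" using r(3) by (simp add: dom_def)
      then have "c / (norm (y t))\<^sup>2 \<le> exp (- 2 * lam * t) * aged lam x t"
        using c(2)[OF sol_nonzero[OF x]] y(3)[OF t] age_sol[OF x t] by metis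
      moreover have "y t \<noteq> 0" using sol_nonzero[OF x] y(3)[OF t] by simp
      ultimately show "c \<le> exp (- 2 * lam * t) * aged lam x t * (norm (y t))\<^sup>2"
        by (simp add: pos_divide_le_eq)
    qed simp
    then have "c \<le> 0" using tendsto_lowerbound[OF lim] by simp
    then show False using c(1) by simp
  qed
qed

lemma trajectory_eq_sol:
  assumes "trajectory (field lam) T x" "x 0 \<noteq> 0" "lam > 0"
  shows "dom lam (x 0) \<subseteq> T" and "\<And>t. t \<in> dom lam (x 0) \<Longrightarrow> x t = sol lam (x 0) t"
proof -
  have eq: "x 0 = sol lam (x 0) 0" using assms(2) by simp
  note ext = trajectory_extends_solution[OF field_lipschitz assms(1) solves_on_sol[OF assms(2,3)] eq]
  show "dom lam (x 0) \<subseteq> T" by (rule ext(1))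
  show "x t = sol lam (x 0) t" if "t \<in> dom lam (x 0)" for t by (rule ext(2)[OF that])
qed

section \<open>The invariant sphere: shape, uniqueness, attraction\<close>

definition attractor :: "real \<Rightarrow> 'a set" where
  "attractor lam = {x. x \<noteq> 0 \<and> age x = 1 / (2 * lam)}"

lemma dom_attractor: "lam > 0 \<Longrightarrow> x \<in> attractor lam \<Longrightarrow> dom lam x = UNIV"
  by (auto simp: dom_def attractor_def aged_def diff_divide_distrib)

lemma flow_invariant_attractor:
  assumes lam: "lam > 0"
  shows "flow_invariant (field lam) (attractor lam)"
  unfolding flow_invariant_def
proof (intro allI impI image_subsetI)
  fix T x t assume "trajectory (field lam) T x \<and> x 0 \<in> attractor lam" and "t \<in> T"
  then have x: "trajectory (field lam) T x" and x0: "x 0 \<in> attractor lam" by auto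
  then have nz: "x 0 \<noteq> 0" and age: "age (x 0) = 1 / (2 * lam)" by (auto simp: attractor_def)
  have t: "t \<in> dom lam (x 0)" using dom_attractor[OF lam x0] by simp
  then have "x t = sol lam (x 0) t" by (rule trajectory_eq_sol(2)[OF x nz lam])
  then show "x t \<in> attractor lam"
    using sol_nonzero[OF nz] age_sol_eq[OF nz lam t] age by (simp add: attractor_def)
qed

text \<open>On the ray through a unit vector u, age(r u) = age(u)/r^2 equals 1/(2 lam) precisely for
  r = sqrt(2 lam age(u)), and this radius depends continuously on u.\<close>

lemma homeomorphism_attractor:
  assumes lam: "lam > 0"
  shows "homeomorphism (attractor lam) (sphere 0 1) sgn (\<lambda>u. sqrt (2 * lam * age u) *\<^sub>R u)"
proof (rule homeomorphismI)
  have nz: "u \<noteq> 0" if "u \<in> sphere 0 1" for u :: 'a using that by auto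
  have pos: "2 * lam * age u > 0" if "u \<in> sphere 0 1" for u using age_pos[OF nz[OF that]] lam by simp
  show "continuous_on (attractor lam) sgn"
    unfolding sgn_div_norm by (intro continuous_intros) (auto simp: attractor_def)
  show "continuous_on (sphere 0 1) (\<lambda>u. sqrt (2 * lam * age u) *\<^sub>R u)"
    by (intro continuous_intros continuous_age)
  show "sgn ` attractor lam \<subseteq> sphere 0 1"
    by (auto simp: attractor_def norm_sgn)
  show "(\<lambda>u. sqrt (2 * lam * age u) *\<^sub>R u) ` sphere 0 1 \<subseteq> attractor lam"
  proof (rule image_subsetI)
    fix u :: 'a assume u: "u \<in> sphere 0 1"
    then have "age (sqrt (2 * lam * age u) *\<^sub>R u) = age u / (2 * lam * age u)"
      using age_scaleR[OF nz[OF u], of "sqrt (2 * lam * age u)"] pos[OF u] by simp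
    then show "sqrt (2 * lam * age u) *\<^sub>R u \<in> attractor lam"
      using pos[OF u] nz[OF u] lam by (auto simp: attractor_def)
  qed
  show "sqrt (2 * lam * age (sgn x)) *\<^sub>R sgn x = x" if "x \<in> attractor lam" for x
  proof -
    have x: "x \<noteq> 0" "age x = 1 / (2 * lam)" using that by (auto simp: attractor_def)
    have "age x = age (norm x *\<^sub>R sgn x)" by simp
    also have "\<dots> = age (sgn x) / (norm x)\<^sup>2" using x(1) by (intro age_scaleR) (auto simp: sgn_zero_iff)
    finally have "2 * lam * age (sgn x) = (norm x)\<^sup>2" using x lam by (simp add: field_simps)
    then show ?thesis by simp
  qed
  show "sgn (sqrt (2 * lam * age u) *\<^sub>R u) = u" if "u \<in> sphere 0 1" for u
  proof -
    have "sgn (sqrt (2 * lam * age u)) = 1" using pos[OF that] by simp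
    moreover have "sgn u = u" using that by (simp add: sgn_div_norm)
    ultimately show ?thesis by (simp only: sgn_scaleR scaleR_one)
  qed
qed

text \<open>The deviation of the age from 1/(2 lam) is multiplied by exp(-2 lam t), which takes
  every positive value. Hence every positive target on the same side of 1/(2 lam) is reached, and v
  > 0 keeps that moment inside \<open>dom\<close>.\<close>

lemma age_sol_attains:
  assumes x: "x \<noteq> 0" and lam: "lam > 0" and v: "v > 0"
    and sign: "(v - 1 / (2 * lam)) / (age x - 1 / (2 * lam)) > 0"
  obtains t where "t \<in> dom lam x" "age (sol lam x t) = v"
proof -
  define t where "t = - ln ((v - 1 / (2 * lam)) / (age x - 1 / (2 * lam))) / (2 * lam)"
  \<comment> \<open>A quotient with denominator 0 has the value 0, so \<open>sign\<close> already
    excludes it.\<close>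
  have ne: "age x - 1 / (2 * lam) \<noteq> 0" using sign by auto
  have "exp (- 2 * lam * t) = (v - 1 / (2 * lam)) / (age x - 1 / (2 * lam))"
    using sign lam by (simp add: t_def)
  then have *: "exp (- 2 * lam * t) * (age x - 1 / (2 * lam)) = v - 1 / (2 * lam)"
    using ne by simp
  have "exp (2 * lam * t) * exp (- 2 * lam * t) = 1" by (simp add: exp_add[symmetric])
  then have "age x - 1 / (2 * lam) = exp (2 * lam * t) * (v - 1 / (2 * lam))"
    unfolding *[symmetric] by (simp add: mult.assoc[symmetric])
  then have "aged lam x t = exp (2 * lam * t) * v"
    by (simp add: aged_def algebra_simps diff_divide_distrib)
  then have t: "t \<in> dom lam x" using v by (simp add: dom_def)
  then have "age (sol lam x t) = v" using age_sol_eq[OF x lam t] * by simp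
  then show thesis using t that by blast
qed

text \<open>Followed backwards, an orbit above the level attains arbitrarily large ages and so comes
  close to 0; one below it attains arbitrarily small positive ages and so runs off to infinity. A
  compact invariant set avoiding 0 permits neither.\<close>

lemma compact_invariant_subset_attractor:
  assumes lam: "lam > 0" and K: "compact K" "0 \<notin> K" "flow_invariant (field lam) K"
  shows "K \<subseteq> attractor lam"
proof
  fix x assume x: "x \<in> K"
  then have nz: "x \<noteq> 0" using K(2) by auto
  have sol: "sol lam x t \<in> K" if "t \<in> dom lam x" for t
    using K(3) trajectory_sol[OF nz lam] x nz that unfolding flow_invariant_def by fastforce
  obtain R where R: "\<And>y. y \<in> K \<Longrightarrow> norm y \<le> R" "R > 0"
    using compact_imp_bounded[OF K(1)] by (metis bounded_pos)
  obtain r where r: "\<And>y. y \<in> K \<Longrightarrow> r \<le> norm y" "r > 0"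
    using separate_point_closed[OF compact_imp_closed[OF K(1)] K(2)] by auto
  obtain c where c: "c > 0" "\<And>x. x \<noteq> 0 \<Longrightarrow> age x \<ge> c / (norm x)\<^sup>2" using age_ge by blast
  define lo hi where "lo = c / R\<^sup>2" and "hi = 1 / (2 * rate * r\<^sup>2)"
  have lohi: "lo \<le> age y" "age y \<le> hi" if "y \<in> K" for y
  proof -
    have y: "y \<noteq> 0" using that K(2) by auto
    have "lo \<le> c / (norm y)\<^sup>2"
      unfolding lo_def using R(1)[OF that] R(2) c(1) y by (intro divide_left_mono power_mono mult_pos_pos) auto
    then show "lo \<le> age y" using c(2)[OF y] by simp
    have "1 / (2 * rate * (norm y)\<^sup>2) \<le> hi"
      unfolding hi_def using r(1)[OF that] r(2) rate_pos y
      by (intro divide_left_mono mult_left_mono power_mono mult_pos_pos) auto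
    then show "age y \<le> hi" using age_le[OF y] by simp
  qed
  have "lo > 0" using c(1) R(2) by (simp add: lo_def)
  have "age x = 1 / (2 * lam)"
  proof (rule ccontr)
    assume "age x \<noteq> 1 / (2 * lam)"
    then consider "age x > 1 / (2 * lam)" | "age x < 1 / (2 * lam)" by linarith
    then show False
    proof cases
      case 1
      define v where "v = max hi (1 / (2 * lam)) + 1"
      have v: "v > 1 / (2 * lam)" "v > hi" by (auto simp: v_def)
      then have "v > 0" using lam by (meson divide_pos_pos less_trans mult_pos_pos zero_less_numeral zero_less_one)
      moreover have "(v - 1 / (2 * lam)) / (age x - 1 / (2 * lam)) > 0"
        using 1 v(1) by (intro divide_pos_pos) auto
      ultimately obtain t where "t \<in> dom lam x" "age (sol lam x t) = v"
        by (rule age_sol_attains[OF nz lam])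
      then show False using lohi(2)[OF sol] v(2) by fastforce
    next
      case 2
      define q v where "q = 1 / (2 * lam)" and "v = min lo q / 2"
      have "q > 0" using lam by (simp add: q_def)
      then have "v < q" and v: "v < lo" "v > 0"
        using \<open>lo > 0\<close> by (auto simp: v_def min_def)
      then have "(v - 1 / (2 * lam)) / (age x - 1 / (2 * lam)) > 0"
        using 2 by (intro divide_neg_neg) (auto simp: q_def)
      with v(2) obtain t where "t \<in> dom lam x" "age (sol lam x t) = v"
        by (rule age_sol_attains[OF nz lam])
      then show False using lohi(1)[OF sol] v(1) by fastforce
    qed
  qed
  then show "x \<in> attractor lam" using nz by (simp add: attractor_def)
qed

lemma globally_attracting_attractor:
  assumes lam: "lam > 0"
  shows "globally_attracting (field lam) (attractor lam)"
  unfolding globally_attracting_def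
proof (intro allI impI conjI)
  fix T x assume "trajectory (field lam) T x \<and> x 0 \<noteq> 0"
  then have x: "trajectory (field lam) T x" and nz: "x 0 \<noteq> 0" by auto
  have dom: "t \<in> dom lam (x 0)" if "t \<ge> 0" for t
    using age_pos[OF nz] aged_mono[OF lam that, of "x 0"] by (simp add: dom_def)
  then show "{0..} \<subseteq> T" using trajectory_eq_sol(1)[OF x nz lam] by auto
  \<comment> \<open>This is 2 lam age(x t) in closed form. Scaling x t by sqrt(w t) moves it
    radially onto the sphere, so the distance is at most |x t| |1 - sqrt(w t)|;
    \<open>age_le\<close> bounds |x t| by sqrt(lam / (rate w t)).\<close>
  define w where "w = (\<lambda>t. 2 * lam * (exp (- 2 * lam * t) * (age (x 0) - 1 / (2 * lam)) + 1 / (2 * lam)))"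
  have "filterlim (\<lambda>t. 2 * lam * t) at_top at_top"
    using lam by (intro filterlim_tendsto_pos_mult_at_top[OF tendsto_const] filterlim_ident) auto
  then have "filterlim (\<lambda>t. - 2 * lam * t) at_bot at_top"
    by (simp add: filterlim_uminus_at_bot)
  then have "((\<lambda>t. exp (- 2 * lam * t)) \<longlongrightarrow> 0) at_top"
    by (rule filterlim_compose[OF exp_at_bot])
  then have "(w \<longlongrightarrow> 2 * lam * (0 * (age (x 0) - 1 / (2 * lam)) + 1 / (2 * lam))) at_top"
    unfolding w_def by (intro tendsto_intros)
  then have w1: "(w \<longlongrightarrow> 1) at_top" using lam by simp
  have "((\<lambda>t. sqrt (lam / (rate * w t)) * \<bar>1 - sqrt (w t)\<bar>) \<longlongrightarrow> sqrt (lam / (rate * 1)) * \<bar>1 - sqrt 1\<bar>) at_top"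
    using rate_pos by (intro tendsto_intros w1) auto
  then have lim: "((\<lambda>t. sqrt (lam / (rate * w t)) * \<bar>1 - sqrt (w t)\<bar>) \<longlongrightarrow> 0) at_top" by simp
  have "\<forall>\<^sub>F t in at_top. norm (infdist (x t) (attractor lam)) \<le> sqrt (lam / (rate * w t)) * \<bar>1 - sqrt (w t)\<bar>"
    using eventually_ge_at_top[of 0]
  proof eventually_elim
    case (elim t)
    note t = dom[OF elim]
    have xt: "x t = sol lam (x 0) t" using trajectory_eq_sol(2)[OF x nz lam t] .
    have xnz: "x t \<noteq> 0" using sol_nonzero[OF nz] xt by simp
    have w: "w t = 2 * lam * age (x t)" unfolding w_def xt age_sol_eq[OF nz lam t] ..
    have wpos: "w t > 0" using w lam age_pos[OF xnz] by simp
    have "age (sqrt (w t) *\<^sub>R x t) = 1 / (2 * lam)"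
      using age_scaleR[OF xnz, of "sqrt (w t)"] wpos lam w age_pos[OF xnz] by simp
    then have "sqrt (w t) *\<^sub>R x t \<in> attractor lam" using wpos xnz by (simp add: attractor_def)
    then have "infdist (x t) (attractor lam) \<le> dist (x t) (sqrt (w t) *\<^sub>R x t)" by (rule infdist_le)
    also have "\<dots> = norm ((1 - sqrt (w t)) *\<^sub>R x t)" by (simp add: dist_norm scaleR_diff_left)
    also have "\<dots> = norm (x t) * \<bar>1 - sqrt (w t)\<bar>" by (simp add: mult.commute)
    also have "\<dots> \<le> sqrt (lam / (rate * w t)) * \<bar>1 - sqrt (w t)\<bar>"
    proof (rule mult_right_mono)
      have "age (x t) * (2 * rate * (norm (x t))\<^sup>2) \<le> 1"
        using age_le[OF xnz] rate_pos xnz by (simp add: pos_le_divide_eq)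
      then have "(norm (x t))\<^sup>2 \<le> 1 / (rate * (2 * age (x t)))"
        using age_pos[OF xnz] rate_pos by (simp add: pos_le_divide_eq mult_ac)
      also have "\<dots> = lam / (rate * w t)" using lam by (simp add: w)
      finally have "(norm (x t))\<^sup>2 \<le> lam / (rate * w t)" .
      then show "norm (x t) \<le> sqrt (lam / (rate * w t))" by (rule real_le_rsqrt)
    qed simp
    finally show ?case by (simp add: infdist_nonneg)
  qed
  then show "((\<lambda>t. infdist (x t) (attractor lam)) \<longlongrightarrow> 0) at_top"
    by (rule Lim_null_comparison[OF _ lim])
qed

section \<open>Equivalence with the projected flow\<close>

lemma flow_invariant_projected_field: "flow_invariant (projected_field Q) (sphere 0 1)"
  unfolding flow_invariant_def
proof (intro allI impI image_subsetI)
  fix T y t assume "trajectory (projected_field Q) T y \<and> y 0 \<in> sphere 0 1" and t: "t \<in> T"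
  then have y: "solves_on (projected_field Q) T y" and y0: "norm (y 0) = 1"
    by (auto simp: trajectory_def)
  define C where "C = {min 0 t..max 0 t}"
  have C: "is_interval C" "0 \<in> C" "t \<in> C" by (auto simp: C_def is_interval_cc)
  have "C \<subseteq> T"
  proof
    fix s assume "s \<in> C"
    moreover have "0 \<in> T" "is_interval T" using y by (auto simp: solves_on_def)
    ultimately show "s \<in> T" using t mem_is_interval_1_I[of T 0 t s] mem_is_interval_1_I[of T t 0 s]
      by (auto simp: C_def min_def max_def split: if_splits)
  qed
  then have dy: "(y has_vector_derivative projected_field Q (y s)) (at s)" if "s \<in> C" for s
    using y that by (auto simp: solves_on_def)
  have "continuous_on C y"
    using dy by (intro continuous_at_imp_continuous_on) (blast intro: has_vector_derivative_continuous)
  then have "continuous_on C (\<lambda>s. Q (y s) \<bullet> y s)"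
    by (intro continuous_intros continuous_on_compose2[OF continuous_Q]) auto
  then have "compact ((\<lambda>s. Q (y s) \<bullet> y s) ` C)"
    unfolding C_def by (rule compact_continuous_image) simp
  then have "bounded ((\<lambda>s. Q (y s) \<bullet> y s) ` C)" by (rule compact_imp_bounded)
  then obtain K where K: "\<And>s. s \<in> C \<Longrightarrow> \<bar>Q (y s) \<bullet> y s\<bar> \<le> K"
    by (auto simp: bounded_iff)
  \<comment> \<open>The quantity |y|^2 - 1 satisfies a linear equation with coefficient -2 Q(y) . y,
    bounded on the compact interval \<open>C\<close>. Its square fits \<open>gronwall\<close>,
    starts at 0 and therefore stays 0.\<close>
  define v where "v = (\<lambda>s. ((norm (y s))\<^sup>2 - 1)\<^sup>2)"
  have "v t \<le> v 0 * exp (4 * K * \<bar>t - 0\<bar>)"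
  proof (rule gronwall[OF C(1) _ _ C(2,3)])
    fix s assume s: "s \<in> C"
    have "projected_field Q (y s) \<bullet> y s = - (Q (y s) \<bullet> y s) * ((norm (y s))\<^sup>2 - 1)"
      by (simp add: projected_field_def inner_diff_left power2_norm_eq_inner algebra_simps)
    then have "((\<lambda>s. (norm (y s))\<^sup>2 - 1) has_real_derivative
        2 * (- (Q (y s) \<bullet> y s) * ((norm (y s))\<^sup>2 - 1))) (at s)"
      using DERIV_diff[OF has_real_derivative_norm_sq[OF dy[OF s]] DERIV_const[of 1]] by simp
    from DERIV_power[OF this, of 2]
    show "(v has_real_derivative - 4 * (Q (y s) \<bullet> y s) * v s) (at s)"
      by (simp add: v_def power2_eq_square algebra_simps)
    have "\<bar>Q (y s) \<bullet> y s\<bar> * v s \<le> K * v s"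
      using K[OF s] by (intro mult_right_mono) (auto simp: v_def)
    then show "\<bar>- 4 * (Q (y s) \<bullet> y s) * v s\<bar> \<le> 4 * K * v s"
      by (simp add: abs_mult v_def)
  qed
  then have "v t \<le> 0" using y0 by (simp add: v_def)
  then have "(norm (y t))\<^sup>2 = 1\<^sup>2" by (simp add: v_def)
  then have "norm (y t) = 1" by (rule power2_eq_imp_eq) simp_all
  then show "y t \<in> sphere 0 1" by simp
qed

lemma topologically_equivalent_attractor:
  assumes lam: "lam > 0"
  shows "topologically_equivalent (field lam) (attractor lam) (projected_field Q) (sphere 0 1)"
  unfolding topologically_equivalent_def
proof (intro conjI exI allI impI)
  show "flow_invariant (field lam) (attractor lam)" by (rule flow_invariant_attractor[OF lam])
  show "flow_invariant (projected_field Q) (sphere 0 1)" by (rule flow_invariant_projected_field)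
  show "homeomorphism (attractor lam) (sphere 0 1) sgn (\<lambda>u. sqrt (2 * lam * age u) *\<^sub>R u)"
    by (rule homeomorphism_attractor[OF lam])
  fix T x assume "trajectory (field lam) T x \<and> x 0 \<in> attractor lam"
  then have x: "trajectory (field lam) T x" and x0: "x 0 \<in> attractor lam" by auto
  then have nz: "x 0 \<noteq> 0" and age: "age (x 0) = 1 / (2 * lam)" by (auto simp: attractor_def)
  have dom: "dom lam (x 0) = UNIV" by (rule dom_attractor[OF lam x0])
  have T: "T = UNIV" using trajectory_eq_sol(1)[OF x nz lam] unfolding dom by blast
  have xt: "x t = sol lam (x 0) t" for t by (rule trajectory_eq_sol(2)[OF x nz lam]) (simp add: dom)
  \<comment> \<open>Stretching does not change directions, so sgn(x t) is the direction of
    \<open>psi\<close> at this time; \<tau> is the change of time from the full field to the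
    projected one.\<close>
  define \<tau> where "\<tau> = (\<lambda>t. clock (x 0) (aged lam (x 0) t))"
  have aged: "aged lam (x 0) t = exp (2 * lam * t) / (2 * lam)" for t
    by (simp add: aged_def age diff_divide_distrib)
  \<comment> \<open>A solution on the whole line is maximal at once.\<close>
  show "trajectory (projected_field Q) UNIV (\<lambda>t. sgn (psi (x 0) t))"
    unfolding trajectory_def solves_on_def using sgn_psi_deriv[OF nz] by auto
  show "strict_mono_on T \<tau>"
  proof (rule strict_mono_onI)
    fix s t :: real assume "s < t"
    then show "\<tau> s < \<tau> t"
      unfolding \<tau>_def using lam by (intro clock_strict_mono nz) (auto simp: aged divide_strict_right_mono)
  qed
  show "\<tau> ` T = UNIV"
  proof -
    have "s \<in> range \<tau>" for s
    proof (rule range_eqI)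
      have "age (psi (x 0) s) > 0" by (intro age_pos psi_nonzero nz)
      \<comment> \<open>The witness solves exp(2 lam t)/(2 lam) = age(psi (x 0) s) for t: on the
        sphere \<open>aged\<close> runs through all positive ages.\<close>
      then show "s = \<tau> (ln (2 * lam * age (psi (x 0) s)) / (2 * lam))"
        using lam by (simp add: \<tau>_def aged clock_age_psi[OF nz])
    qed
    then show ?thesis using T by auto
  qed
  show "\<forall>t\<in>T. sgn (x t) = sgn (psi (x 0) (\<tau> t))"
  proof
    show "sgn (x t) = sgn (psi (x 0) (\<tau> t))" for t
      unfolding xt[of t] by (simp add: sol_def \<tau>_def sgn_scaleR)
  qed
qed

end

theorem corollary1:
  fixes a b c d :: real and e :: "nat \<Rightarrow> 'n::finite"
  assumes "bij_betw e {1..CARD('n)} UNIV"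
    and "\<exists>k. a < k \<and> k < 0 \<and>
      ((quartic_Delta a b c d k > 0 \<and> (quartic_P a b c d k > 0 \<or> quartic_D a b c d k > 0)) \<or>
       (quartic_Delta a b c d k = 0 \<and> quartic_D a b c d k = 0 \<and> quartic_R a b c d k = 0 \<and>
        quartic_P a b c d k > 0))"
  shows "\<forall>lam>0. \<exists>S.
      (is_sphere S \<and> 0 \<notin> S \<and> flow_invariant (\<lambda>x. lam *\<^sub>R x + Q_N e (cubic a b c d) x) S) \<and>
      (\<forall>S'. is_sphere S' \<and> 0 \<notin> S' \<and>
         flow_invariant (\<lambda>x. lam *\<^sub>R x + Q_N e (cubic a b c d) x) S' \<longrightarrow> S' = S) \<and>
      globally_attracting (\<lambda>x. lam *\<^sub>R x + Q_N e (cubic a b c d) x) S \<and>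
      topologically_equivalent (\<lambda>x. lam *\<^sub>R x + Q_N e (cubic a b c d) x) S
        (projected_field (Q_N e (cubic a b c d))) (sphere 0 1)"
proof (intro allI impI)
  fix lam :: real assume lam: "lam > 0"
  from assms(2) obtain k where k: "a < k" "k < 0"
      "(quartic_Delta a b c d k > 0 \<and> (quartic_P a b c d k > 0 \<or> quartic_D a b c d k > 0)) \<or>
       (quartic_Delta a b c d k = 0 \<and> quartic_D a b c d k = 0 \<and> quartic_R a b c d k = 0 \<and>
        quartic_P a b c d k > 0)"
    by blast
  interpret dissipative_cubic "Q_N e (cubic a b c d)"
    by unfold_locales
       (rule Q_N_cubic_scaleR Q_N_cubic_lipschitz Q_N_inner_neg[OF assms(1) k] | assumption)+
  have sph: "is_sphere (attractor lam)"
    using homeomorphism_attractor[OF lam] unfolding is_sphere_def homeomorphic_def by blast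
  show "\<exists>S.
      (is_sphere S \<and> 0 \<notin> S \<and> flow_invariant (field lam) S) \<and>
      (\<forall>S'. is_sphere S' \<and> 0 \<notin> S' \<and> flow_invariant (field lam) S' \<longrightarrow> S' = S) \<and>
      globally_attracting (field lam) S \<and>
      topologically_equivalent (field lam) S (projected_field (Q_N e (cubic a b c d))) (sphere 0 1)"
  proof (intro exI conjI allI impI)
    fix S' assume S': "is_sphere S' \<and> 0 \<notin> S' \<and> flow_invariant (field lam) S'"
    \<comment> \<open>Compactness yields the inclusion of S' in the attractor; the topology of S'
      then turns it into an equality through \<open>sphere_subset_sphere_eq\<close>.\<close>
    then have "compact S'"
      using homeomorphic_compactness[of S' "sphere (0 :: real ^ 'n) 1"] by (simp add: is_sphere_def)
    then have "S' \<subseteq> attractor lam"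
      using S' by (intro compact_invariant_subset_attractor lam) auto
    with S' sph show "S' = attractor lam"
      unfolding is_sphere_def by (intro sphere_subset_sphere_eq) auto
  next
    show "0 \<notin> attractor lam" by (simp add: attractor_def)
  qed (rule sph flow_invariant_attractor[OF lam] globally_attracting_attractor[OF lam]
      topologically_equivalent_attractor[OF lam])+
qed

end
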